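(* Let $n$ and $r$ be positive integers with $n> 4r$, and let $\mathcal{F}\subset 2^{[n]}$ be a $(2r+1)$-union family. Then $$|\mathcal{F}^{(\geq r+1)}|\leq \binom{n-1}{r},$$ with equality if and only if $\mathcal{F}^{(\geq r+1)}=\mathcal{S}(n,r+1,1)$ up to isomorphism (that is, up to a permutation of $[n]$).
   Context: $[n]=\{1,2,\ldots,n\}$, $2^{[n]}$ is its power set, and $\binom{[n]}{k}$ is the family of all $k$-element subsets of $[n]$. For a positive integer $u$, a family $\mathcal{F}\subset 2^{[n]}$ is called $u$-union if $|F\cup F'|\leq u$ for all $F,F'\in\mathcal{F}$ (including $F=F'$). For an integer $\ell$, $\mathcal{F}^{(\geq \ell)}=\{F\in\mathcal{F}\colon |F|\geq \ell\}$. The full star is $\mathcal{S}(n,k,1)=\{S\in\binom{[n]}{k}\colon 1\in S\}$.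
   Formalization: The "only if" part of the equality case is claimed for all (n,r) except (5,1), where it fails: the family of all subsets of {1,2,3} is 3-union with 4 = C(4,1) sets of size at least 2, but these do not form a star. *)

theory Defs
  imports Main "HOL-Combinatorics.Permutations"
begin

text \<open>A set family on \<open>[n]\<close> is a \<open>nat set set\<close> contained in \<open>Pow {1..n}\<close>.\<close>

definition union_bounded :: "nat \<Rightarrow> nat set set \<Rightarrow> bool" where
  "union_bounded u \<F> \<longleftrightarrow> (\<forall>F\<in>\<F>. \<forall>F'\<in>\<F>. card (F \<union> F') \<le> u)"

definition level_ge :: "nat set set \<Rightarrow> nat \<Rightarrow> nat set set" where
  "level_ge \<F> l = {F \<in> \<F>. card F \<ge> l}"

text \<open>The full star \<open>S(n,k,1)\<close>.\<close>

definition full_star :: "nat \<Rightarrow> nat \<Rightarrow> nat set set" where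
  "full_star n k = {S. S \<subseteq> {1..n} \<and> card S = k \<and> 1 \<in> S}"

definition isomorphic_families :: "nat \<Rightarrow> nat set set \<Rightarrow> nat set set \<Rightarrow> bool" where
  "isomorphic_families n \<A> \<B> \<longleftrightarrow> (\<exists>\<pi>. \<pi> permutes {1..n} \<and> \<A> = (\<lambda>B. \<pi> ` B) ` \<B>)"

text \<open>For \<open>n = 5\<close> and \<open>r = 1\<close>, the family of all subsets of \<open>{1,2,3}\<close> also attains the
  bound \<open>(n - 1) choose r = 4\<close>, but is not isomorphic to a star on the level in question. The
  uniqueness claim therefore has to exclude this one pair of parameters.\<close>

lemma uniqueness_fails_5_1:
  fixes n r :: nat
  assumes "n = 5" and "r = 1"
  shows "\<exists>\<F>. \<F> \<subseteq> Pow {1..n} \<and> union_bounded (2 * r + 1) \<F>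
    \<and> card (level_ge \<F> (r + 1)) = (n - 1) choose r
    \<and> \<not> isomorphic_families n (level_ge \<F> (r + 1)) (full_star n (r + 1))"
proof (intro exI conjI)
  let ?F = "Pow {1, 2, 3 :: nat}"
  show "?F \<subseteq> Pow {1..n}" using assms by auto
  show "union_bounded (2 * r + 1) ?F"
    unfolding union_bounded_def
  proof (intro ballI)
    fix A B assume "A \<in> ?F" "B \<in> ?F"
    then have "card (A \<union> B) \<le> card {1, 2, 3 :: nat}" by (intro card_mono) auto
    then show "card (A \<union> B) \<le> 2 * r + 1" using assms by simp
  qed
  have level: "level_ge ?F (r + 1) = {{1,2}, {1,3}, {2,3}, {1,2,3}}"
    using assms by (auto simp: level_ge_def Pow_insert)
  have ne: "{1,2} \<noteq> {1,3::nat}" "{1,2} \<noteq> {2,3::nat}" "{1,3} \<noteq> {2,3::nat}"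
    "{1,2} \<noteq> {1,2,3::nat}" "{1,3} \<noteq> {1,2,3::nat}" "{2,3} \<noteq> {1,2,3::nat}"
    by (auto simp: doubleton_eq_iff dest: arg_cong[where f = card])
  then show "card (level_ge ?F (r + 1)) = (n - 1) choose r"
    unfolding level using assms by simp
  show "\<not> isomorphic_families n (level_ge ?F (r + 1)) (full_star n (r + 1))"
  proof
    assume "isomorphic_families n (level_ge ?F (r + 1)) (full_star n (r + 1))"
    then obtain \<pi> where \<pi>: "\<pi> permutes {1..n}"
      and eq: "level_ge ?F (r + 1) = (\<lambda>B. \<pi> ` B) ` full_star n (r + 1)"
      unfolding isomorphic_families_def by blast
    have "{1, 2, 3} \<in> (\<lambda>B. \<pi> ` B) ` full_star n (r + 1)"
      unfolding eq[symmetric] level by blast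
    then obtain S where S: "card S = r + 1" "{1, 2, 3} = \<pi> ` S"
      unfolding full_star_def by blast
    have "card (\<pi> ` S) = card S"
      by (intro card_image inj_on_subset[OF permutes_inj[OF \<pi>]]) auto
    then have "card {1, 2, 3 :: nat} = r + 1" using S by metis
    then show False using assms by simp
  qed
qed

end

theory Submission
  imports Defs Complex_Main
begin

text \<open>Left shifting and closing under subsets reduce the problem to a shifted down-set \<open>F\<close>; equality
  is pulled back through a shift by connectivity of Kneser graphs. Sort the members of \<open>F\<close> by
  their trace on \<open>{1,2,3}\<close>. If no set \<open>{2,3} \<union> Q\<close> with \<open>card Q = r - 1\<close> is in \<open>F\<close>, the upper levels lie
  inside the star at 1. Otherwise each member outside the star forces members of the star to be missing:
  \<open>T \<union> D\<close> and \<open>T' \<union> E\<close> cannot both be in \<open>F\<close> when \<open>D, E\<close> are disjoint and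
  \<open>card (T \<union> T') + card D + card E > 2 * r + 1\<close>. The missing sets are counted with two estimates for
  the number of \<open>l\<close>-sets avoiding some member of a shifted family: Katona's shadow theorem, and a bound \<open>1 - (1 - \<alpha>)\<^sup>2\<close> on their density
  when the family has density \<open>\<alpha>\<close>. For \<open>r \<ge> 2\<close> strictly more sets are missing than were gained.\<close>

section \<open>Sets avoiding a member of a shifted family\<close>

text \<open>With \<open>m = n - 3\<close> the bound is
  \<open>(m choose r) + 2 * (m choose (r - 1)) + (m choose (r - 2))\<close>: the capacities of the
  traces {1}, {1,2}, {1,3}, {1,2,3}. Each trace outside the star is played against its complement in
  {1,2,3}, because sets of size \<open>r + 1\<close> with complementary traces and disjoint
  remainders have a union of size \<open>2 * r + 2\<close>. Two estimates are needed because the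
  pair {2,3}, {1} resists shadow theorems: remainders in \<open>fiber {2,3} (r - 1)\<close> have at
  most \<open>2 * r - 2\<close> points in union anyway, so the union condition among them is void
  and gives no hold on the density of this fiber. The density bound still yields about twice the
  density when the fiber is small. For the traces {2}, {3} and {} shifting forces unions of at most
  \<open>2 * r - 2\<close> points, below the trivial size, and Katona's theorem gains a factor of at
  least 3. Both estimates come from one recursion on the least point. The hypothesis
  \<open>n > 4 * r\<close> enters as \<open>m \<ge> 4 * k + 2\<close> with \<open>k = r - 1\<close>,
  which governs the constants 3, 20 and 5/2.\<close>

definition left_shifted :: "'a::linorder set \<Rightarrow> 'a set set \<Rightarrow> bool" where
  "left_shifted X H \<longleftrightarrow>
    (\<forall>D\<in>H. \<forall>i\<in>X. \<forall>j\<in>D. i < j \<longrightarrow> i \<notin> D \<longrightarrow> insert i (D - {j}) \<in> H)"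

text \<open>In terms of complements this is the level-\<open>l\<close> shadow of the family of all
  \<open>X - D\<close> with \<open>D \<in> H\<close>. The form with disjoint sets is the one that
  meets the union condition directly.\<close>

definition avoiders :: "'a set \<Rightarrow> nat \<Rightarrow> 'a set set \<Rightarrow> 'a set set" where
  "avoiders X l H = {E. E \<subseteq> X \<and> card E = l \<and> (\<exists>D\<in>H. D \<inter> E = {})}"

definition link :: "'a set \<Rightarrow> 'a \<Rightarrow> 'a set set \<Rightarrow> 'a set set" where
  "link X b H = {D. D \<subseteq> X \<and> insert b D \<in> H}"

definition deletion :: "'a \<Rightarrow> 'a set set \<Rightarrow> 'a set set" where
  "deletion b H = {D \<in> H. b \<notin> D}"

section \<open>Splitting a family at one point\<close>

lemma left_shiftedD:
  "left_shifted X H \<Longrightarrow> D \<in> H \<Longrightarrow> i \<in> X \<Longrightarrow> j \<in> D \<Longrightarrow> i < j \<Longrightarrow> i \<notin> D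
    \<Longrightarrow> insert i (D - {j}) \<in> H"
  unfolding left_shifted_def by blast

lemma finite_avoiders: "finite X \<Longrightarrow> finite (avoiders X l H)"
  unfolding avoiders_def by (rule finite_subset[of _ "Pow X"]) auto

lemma inj_on_insert: "inj_on (insert b) {D. b \<notin> D}"
  by (rule inj_onI) (auto simp: set_eq_iff)

lemma card_link_deletion:
  assumes "finite X" "b \<notin> X" "H \<subseteq> Pow (insert b X)"
  shows "card H = card (link X b H) + card (deletion b H)"
proof -
  have fH: "finite H" using assms(1,3) by (meson finite_Pow_iff finite_insert finite_subset)
  have e: "H = insert b ` link X b H \<union> deletion b H"
  proof
    show "H \<subseteq> insert b ` link X b H \<union> deletion b H"
    proof
      fix D assume D: "D \<in> H"
      show "D \<in> insert b ` link X b H \<union> deletion b H"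
      proof (cases "b \<in> D")
        case True
        then have "D = insert b (D - {b})" by auto
        moreover have "D - {b} \<in> link X b H" using D assms(3) True unfolding link_def
          by (auto simp: insert_absorb)
        ultimately show ?thesis by blast
      qed (use D in \<open>auto simp: deletion_def\<close>)
    qed
  qed (auto simp: link_def deletion_def)
  have "finite (link X b H)" unfolding link_def
    by (rule finite_subset[of _ "Pow X"]) (use assms(1) in auto)
  moreover have "inj_on (insert b) (link X b H)"
    by (rule inj_on_subset[OF inj_on_insert]) (use assms(2) in \<open>auto simp: link_def\<close>)
  moreover have "insert b ` link X b H \<inter> deletion b H = {}" by (auto simp: deletion_def)
  moreover have "finite (deletion b H)" using fH by (auto simp: deletion_def)
  ultimately show ?thesis
    using card_Un_disjoint[of "insert b ` link X b H" "deletion b H"] card_image e by fastforce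
qed

text \<open>A set \<open>E\<close> without \<open>b\<close> remains disjoint from \<open>D\<close>
  when \<open>b\<close> is added to \<open>D\<close>, so the link serves it; a set \<open>E\<close>
  with \<open>b\<close> is served by members lacking \<open>b\<close>, that is, by the deletion.
  This is the recursion behind both avoidance estimates.\<close>

lemma avoiders_insert:
  assumes "finite X" "b \<notin> X"
  shows "card (avoiders X (Suc l) (link X b H)) + card (avoiders X l (deletion b H))
    \<le> card (avoiders (insert b X) (Suc l) H)"
proof -
  let ?P = "avoiders X (Suc l) (link X b H)" and ?Q = "insert b ` avoiders X l (deletion b H)"
  have "?P \<subseteq> avoiders (insert b X) (Suc l) H"
  proof
    fix E assume "E \<in> ?P"
    then obtain D where D: "insert b D \<in> H" "D \<inter> E = {}" and E: "E \<subseteq> X" "card E = Suc l"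
      unfolding avoiders_def link_def by auto
    have "insert b D \<inter> E = {}" using D E assms by auto
    then show "E \<in> avoiders (insert b X) (Suc l) H" using D E unfolding avoiders_def by blast
  qed
  moreover have "?Q \<subseteq> avoiders (insert b X) (Suc l) H"
  proof
    fix E assume "E \<in> ?Q"
    then obtain E' D where E: "E = insert b E'" "E' \<subseteq> X" "card E' = l" and D: "D \<in> H" "b \<notin> D" "D \<inter> E' = {}"
      unfolding avoiders_def deletion_def by auto
    have "card E = Suc l" using E assms finite_subset[of E' X] by (metis card_insert_disjoint subsetD)
    moreover have "D \<inter> E = {}" using E D by auto
    ultimately show "E \<in> avoiders (insert b X) (Suc l) H" using E D unfolding avoiders_def by blast
  qed
  moreover have "?P \<inter> ?Q = {}" using assms(2) by (auto simp: avoiders_def)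
  moreover have "card ?Q = card (avoiders X l (deletion b H))"
    by (rule card_image, rule inj_on_subset[OF inj_on_insert]) (use assms(2) in \<open>auto simp: avoiders_def\<close>)
  ultimately show ?thesis
    using assms(1) card_Un_disjoint[of ?P ?Q] finite_avoiders
    by (metis Un_subset_iff card_mono finite.insertI finite_imageI)
qed

lemma left_shifted_link:
  assumes "b \<notin> X" "left_shifted (insert b X) H"
  shows "left_shifted X (link X b H)"
  unfolding left_shifted_def
proof (intro ballI impI)
  fix D i j assume *: "D \<in> link X b H" "i \<in> X" "j \<in> D" "i < j" "i \<notin> D"
  then have D: "D \<subseteq> X" "insert b D \<in> H" unfolding link_def by auto
  have "insert i (insert b D - {j}) \<in> H"
    by (rule left_shiftedD[OF assms(2) D(2)]) (use * D assms in auto)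
  moreover have "insert i (insert b D - {j}) = insert b (insert i (D - {j}))"
    using * D assms by auto
  ultimately show "insert i (D - {j}) \<in> link X b H" using * D unfolding link_def by auto
qed

lemma left_shifted_deletion:
  assumes "b \<notin> X" "left_shifted (insert b X) H"
  shows "left_shifted X (deletion b H)"
  using assms unfolding left_shifted_def deletion_def by auto

section \<open>Local LYM inequalities by double counting\<close>

lemma avoiders_LYM:
  assumes X: "finite X" and H: "H \<subseteq> {D. D \<subseteq> X \<and> card D = k}" and kl: "k + l \<le> card X"
  shows "card H * (card X choose l) \<le> card (avoiders X l H) * (card X choose k)"
proof -
  define m where "m = card X"
  have fH: "finite H" using X H by (metis (no_types, lifting) finite_Pow_iff finite_subset mem_Collect_eq Pow_iff subsetI subset_iff)
  let ?W = "avoiders X l H"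
  have deg: "card {E\<in>?W. D \<inter> E = {}} = (m - k) choose l" if "D \<in> H" for D
  proof -
    have D: "D \<subseteq> X" "card D = k" using that H by auto
    have "{E\<in>?W. D \<inter> E = {}} = {E. E \<subseteq> X - D \<and> card E = l}"
      unfolding avoiders_def using that by blast
    then show ?thesis using n_subsets[of "X - D" l] X D by (simp add: card_Diff_subset finite_subset m_def)
  qed
  have deg': "card {D\<in>H. D \<inter> E = {}} \<le> (m - l) choose k" if "E \<in> ?W" for E
  proof -
    have E: "E \<subseteq> X" "card E = l" using that by (auto simp: avoiders_def)
    have "{D\<in>H. D \<inter> E = {}} \<subseteq> {D. D \<subseteq> X - E \<and> card D = k}" using H by blast
    then have "card {D\<in>H. D \<inter> E = {}} \<le> card {D. D \<subseteq> X - E \<and> card D = k}"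
      by (rule card_mono[rotated]) (use X in simp)
    then show ?thesis using n_subsets[of "X - E" k] X E by (simp add: card_Diff_subset finite_subset m_def)
  qed
  have "card H * ((m - k) choose l) = (\<Sum>D\<in>H. card {E\<in>?W. D \<inter> E = {}})" using deg by simp
  also have "\<dots> = (\<Sum>E\<in>?W. card {D\<in>H. D \<inter> E = {}})"
    using sum.swap_restrict[of H ?W "\<lambda>_ _. 1::nat" "\<lambda>D E. D \<inter> E = {}"] fH finite_avoiders[OF X] by simp
  also have "\<dots> \<le> card ?W * ((m - l) choose k)" using sum_bounded_above[OF deg'] by simp
  finally have 1: "card H * ((m - k) choose l) \<le> card ?W * ((m - l) choose k)" .
  \<comment> \<open>Both sides count ordered pairs of disjoint sets of sizes \<open>k\<close> and
    \<open>l\<close> in an \<open>m\<close>-set; this turns the ratio of degrees into the ratio of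
    level sizes.\<close>
  have 2: "(m choose k) * ((m - k) choose l) = (m choose l) * ((m - l) choose k)"
    using choose_mult[of k "k + l" m] choose_mult[of l "k + l" m] kl
    by (simp add: m_def binomial_symmetric[of k "k+l"])
  have "card H * (m choose l) * ((m - l) choose k) = (m choose k) * (card H * ((m - k) choose l))"
    using 2 by (simp add: algebra_simps)
  also have "\<dots> \<le> (m choose k) * (card ?W * ((m - l) choose k))" using 1 by (rule mult_left_mono) simp
  finally have "card H * (m choose l) * ((m - l) choose k) \<le> (card ?W * (m choose k)) * ((m - l) choose k)"
    by (simp add: algebra_simps)
  moreover have "(m - l) choose k > 0" using kl by (simp add: m_def)
  ultimately show ?thesis unfolding m_def[symmetric] by (meson mult_right_le_imp_le)
qed

text \<open>Local LYM for any \<open>G\<close> containing the lower shadow. It is applied with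
  \<open>H\<close> the deletion and \<open>G\<close> the link of a shifted family: exchanging a
  point for the least one puts the shadow of the deletion into the link.\<close>

lemma shadow_LYM:
  assumes X: "finite X" and H: "H \<subseteq> {D. D \<subseteq> X \<and> card D = k}" and G: "G \<subseteq> Pow X"
    and sub: "\<And>D d. D \<in> H \<Longrightarrow> d \<in> D \<Longrightarrow> D - {d} \<in> G"
    and cG: "\<And>Q. Q \<in> G \<Longrightarrow> card Q = k - 1" and k: "k \<ge> 1"
  shows "card H * k \<le> card G * (card X - k + 1)"
proof -
  have fH: "finite H" using X H by (metis (no_types, lifting) finite_Pow_iff finite_subset mem_Collect_eq Pow_iff subsetI subset_iff)
  have fG: "finite G" using X G by (meson finite_Pow_iff finite_subset)
  let ?R = "\<lambda>D Q. \<exists>d\<in>D. Q = D - {d}"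
  have deg: "card {Q\<in>G. ?R D Q} = k" if "D \<in> H" for D
  proof -
    have "{Q\<in>G. ?R D Q} = (\<lambda>d. D - {d}) ` D" using sub that by auto
    moreover have "inj_on (\<lambda>d. D - {d}) D" by (rule inj_onI) (auto simp: set_eq_iff)
    ultimately show ?thesis using H that by (auto simp: card_image)
  qed
  have deg': "card {D\<in>H. ?R D Q} \<le> card X - k + 1" if Q: "Q \<in> G" for Q
  proof -
    have "{D\<in>H. ?R D Q} \<subseteq> (\<lambda>d. insert d Q) ` (X - Q)"
    proof
      fix D assume "D \<in> {D\<in>H. ?R D Q}"
      then obtain d where "D \<in> H" "d \<in> D" "Q = D - {d}" by auto
      then have "D = insert d Q" "d \<in> X - Q" using H by auto
      then show "D \<in> (\<lambda>d. insert d Q) ` (X - Q)" by blast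
    qed
    then have "card {D\<in>H. ?R D Q} \<le> card (X - Q)"
      using X by (meson surj_card_le finite_Diff)
    also have "\<dots> = card X - (k - 1)" using cG[OF Q] G Q X
      by (metis Pow_iff card_Diff_subset finite_subset subsetD)
    also have "\<dots> \<le> card X - k + 1" using k by simp
    finally show ?thesis .
  qed
  have "card H * k = (\<Sum>D\<in>H. card {Q\<in>G. ?R D Q})" using deg by simp
  also have "\<dots> = (\<Sum>Q\<in>G. card {D\<in>H. ?R D Q})"
    using sum.swap_restrict[of H G "\<lambda>_ _. 1::nat" ?R] fH fG by simp
  also have "\<dots> \<le> card G * (card X - k + 1)" using sum_bounded_above[OF deg'] by simp
  finally show ?thesis .
qed

text \<open>In Katona's recursion the deletion lowers \<open>card X\<close>, \<open>l\<close> and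
  \<open>j\<close> by one each, hence \<open>card X + j - k\<close> by two; this ratio tracks both
  binomials along that diagonal.\<close>

lemma choose_step_diagonal:
  assumes "1 \<le> i" "i < N"
  shows "N * (N - 1) * ((N - 2) choose (i - 1)) = i * (N - i) * (N choose i)"
proof -
  obtain i' where i': "i = Suc i'" using assms(1) by (cases i) auto
  have "2 \<le> N" using assms by linarith
  then obtain N' where "N = 2 + N'" using le_Suc_ex by blast
  then have N': "N = Suc (Suc N')" by simp
  have a: "Suc i' * (Suc (Suc N') choose Suc i') = Suc (Suc N') * (Suc N' choose i')"
    using Suc_times_binomial by blast
  have b: "(Suc N' - i') * (Suc N' choose i') = Suc N' * (N' choose i')"
    using binomial_absorb_comp[of "Suc N'" i'] by simp
  have "Suc i' * (Suc N' - i') * (Suc (Suc N') choose Suc i')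
      = (Suc N' - i') * (Suc i' * (Suc (Suc N') choose Suc i'))" by (simp only: ac_simps)
  also have "\<dots> = Suc (Suc N') * ((Suc N' - i') * (Suc N' choose i'))" unfolding a by (simp only: ac_simps)
  also have "\<dots> = Suc (Suc N') * Suc N' * (N' choose i')" unfolding b by (simp only: ac_simps)
  finally show ?thesis unfolding i' N' by simp
qed

text \<open>By \<open>choose_step_diagonal\<close> on both sides this reduces to
  \<open>j * (N - j) \<le> l * (N - l)\<close>, true because \<open>x * (N - x)\<close> is concave
  and symmetric about \<open>N / 2\<close> and \<open>j \<le> l \<le> N - j\<close>.\<close>

lemma choose_diagonal_le:
  "(N choose l) * ((N - 2) choose (j - 1)) \<le> ((N - 2) choose (l - 1)) * (N choose j)"
  if j1: "1 \<le> j" and jl: "j \<le> l" and ljN: "l + j \<le> N"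
proof -
  show ?thesis
  proof (cases "l < N")
    case True
    have jN: "j < N" using True jl by linarith
    have le: "j * (N - j) \<le> l * (N - l)"
    proof -
      obtain d where d: "l = j + d" using jl le_Suc_ex by blast
      obtain e where e: "N = l + j + e" using ljN le_Suc_ex by blast
      show ?thesis unfolding e d by (simp add: algebra_simps)
    qed
    have N: "N * (N - 1) > 0" using j1 jl ljN by auto
    have "N * (N - 1) * ((N choose l) * ((N - 2) choose (j - 1))) = (N choose l) * (N choose j) * (j * (N - j))"
      using choose_step_diagonal[OF j1 jN] by (simp add: algebra_simps)
    also have "\<dots> \<le> (N choose l) * (N choose j) * (l * (N - l))" using le by simp
    also have "\<dots> = N * (N - 1) * (((N - 2) choose (l - 1)) * (N choose j))"
      using choose_step_diagonal[of l N] j1 jl True by (simp add: algebra_simps)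
    finally show ?thesis using N by (meson mult_le_cancel1)
  next
    case False
    then show ?thesis using j1 jl ljN by simp
  qed
qed

lemma mult_chain_le:
  fixes a b x y z w :: nat
  assumes "a * x \<le> b * y" "z * y \<le> x * w"
  shows "(a * z) * y \<le> (b * w) * y"
proof -
  have "(a * z) * y \<le> a * (x * w)" using assms(2) by simp
  also have "\<dots> = (a * x) * w" by simp
  also have "\<dots> \<le> (b * y) * w" using assms(1) by (rule mult_right_mono) simp
  finally show ?thesis by (simp add: ac_simps)
qed

text \<open>Katona's intersecting shadow theorem for the complements. Removing the least point \<open>b\<close>,
  the link keeps \<open>card X + j - k\<close>, while the deletion is \<open>(k + j - 1)\<close>-union since two members
  meet and one common point may be shifted to \<open>b\<close>.\<close>

lemma avoiders_Katona:
  fixes X :: "'a::linorder set"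
  assumes "finite X" and "H \<subseteq> {D. D \<subseteq> X \<and> card D = k}" and "left_shifted X H"
    and "\<And>D D'. D \<in> H \<Longrightarrow> D' \<in> H \<Longrightarrow> card (D \<union> D') \<le> k + j"
    and "j \<le> k" "j \<le> l" "k + l \<le> card X"
  shows "card H * ((card X + j - k) choose l) \<le> card (avoiders X l H) * ((card X + j - k) choose j)"
  using assms
proof (induction X arbitrary: H k j l rule: finite_linorder_min_induct)
  case empty
  then show ?case using avoiders_LYM[of "{}" H k l] by simp
next
  case (insert b X)
  have bX: "b \<notin> X" using insert.hyps by auto
  have cX: "card (insert b X) = Suc (card X)" using bX insert.hyps by simp
  have fin: "finite (insert b X)" using insert.hyps by simp
  show ?case
  proof (cases "j = k")
    \<comment> \<open>With \<open>j = k\<close> the union bound holds for any two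
      \<open>k\<close>-sets, and the claim is local LYM.\<close>
    case True
    then show ?thesis using avoiders_LYM[OF fin insert.prems(1) insert.prems(6)] by simp
  next
    case False
    then have jk: "j < k" using insert.prems by simp
    let ?L = "link X b H" and ?D = "deletion b H"
    let ?N = "card (insert b X) + j - k"
    have HP: "H \<subseteq> Pow (insert b X)" using insert.prems(1) by auto
    have cH: "card H = card ?L + card ?D"
      by (rule card_link_deletion[OF insert.hyps(1) bX HP])
    have sL: "left_shifted X ?L" and sD: "left_shifted X ?D"
      using left_shifted_link[OF bX] left_shifted_deletion[OF bX] insert.prems(2) by auto
    have finD: "finite D" if "D \<in> H" for D using that HP fin finite_subset by blast
    have L: "?L \<subseteq> {D. D \<subseteq> X \<and> card D = k - 1}"
    proof
      fix D assume "D \<in> ?L"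
      then have D: "D \<subseteq> X" "insert b D \<in> H" by (auto simp: link_def)
      then have "card (insert b D) = k" using insert.prems(1) by auto
      then show "D \<in> {D. D \<subseteq> X \<and> card D = k - 1}"
        using D(1) bX by (metis (mono_tags, lifting) card_insert_disjoint diff_Suc_1 finite_subset insert.hyps(1) mem_Collect_eq subsetD)
    qed
    have D: "?D \<subseteq> {D. D \<subseteq> X \<and> card D = k}"
      using insert.prems(1) by (auto simp: deletion_def)
    have L_union: "card (D \<union> D') \<le> (k - 1) + j" if "D \<in> ?L" "D' \<in> ?L" for D D'
    proof -
      have "card (insert b D \<union> insert b D') \<le> k + j" by (rule insert.prems(3)) (use that in \<open>auto simp: link_def\<close>)
      moreover have "insert b D \<union> insert b D' = insert b (D \<union> D')" by auto
      moreover have "b \<notin> D \<union> D'" "finite (D \<union> D')" using that bX insert.hyps(1) by (auto simp: link_def intro: finite_subset)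
      ultimately show ?thesis using jk by simp
    qed
    have D_union: "card (D \<union> D') < k + j" if DD: "D \<in> ?D" "D' \<in> ?D" for D D'
    proof (rule ccontr)
      assume "\<not> card (D \<union> D') < k + j"
      moreover have DH: "D \<in> H" "D' \<in> H" "b \<notin> D" "b \<notin> D'" using DD by (auto simp: deletion_def)
      ultimately have eq: "card (D \<union> D') = k + j" using insert.prems(3)[of D D'] by simp
      have cDD: "card D = k" "card D' = k" using DH insert.prems(1) by auto
      have "D \<inter> D' \<noteq> {}" using eq jk card_Un_disjoint[of D D'] cDD finD DH by auto
      then obtain x where x: "x \<in> D" "x \<in> D'" by auto
      have "x \<in> X" using x DH HP by auto
      then have "insert b (D - {x}) \<in> H"
        using left_shiftedD[OF insert.prems(2) DH(1), of b x] insert.hyps x DH by auto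
      then have "card (insert b (D - {x}) \<union> D') \<le> k + j" by (rule insert.prems(3)) (rule DH(2))
      moreover have e: "insert b (D - {x}) \<union> D' = insert b (D \<union> D')" using x by auto
      moreover have "card (insert b (D \<union> D')) = Suc (card (D \<union> D'))" using DH finD by simp
      ultimately show False using eq unfolding e by linarith
    qed
    have IHL: "card ?L * (?N choose l) \<le> card (avoiders X l ?L) * (?N choose j)"
    proof -
      have "card X + j - (k - 1) = ?N" using jk cX by simp
      moreover have "card ?L * ((card X + j - (k - 1)) choose l)
          \<le> card (avoiders X l ?L) * ((card X + j - (k - 1)) choose j)"
        by (rule insert.IH[OF L sL L_union _ \<open>j \<le> l\<close>]) (use jk insert.prems(6) cX in auto)
      ultimately show ?thesis by simp
    qed
    have IHD: "card ?D * (?N choose l) \<le> card (avoiders X (l - 1) ?D) * (?N choose j)"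
    proof (cases "j = 0")
      case True
      \<comment> \<open>For \<open>j = 0\<close> the strict bound \<open>D_union\<close> would give
        a \<open>k\<close>-set fewer than \<open>k\<close> elements.\<close>
      have "?D = {}"
      proof (rule ccontr)
        assume "?D \<noteq> {}"
        then obtain D0 where "D0 \<in> ?D" by auto
        then show False using D_union[of D0 D0] True D by auto
      qed
      then show ?thesis by simp
    next
      case False
      have N2: "card X + (j - 1) - k = ?N - 2" using cX False by simp
      have jN: "l + j \<le> ?N" using insert.prems(6) jk by simp
      have "card ?D * ((?N - 2) choose (l - 1)) \<le> card (avoiders X (l - 1) ?D) * ((?N - 2) choose (j - 1))"
      proof -
        have u: "card (D \<union> D') \<le> k + (j - 1)" if "D \<in> ?D" "D' \<in> ?D" for D D'
          using D_union[OF that] False by simp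
        show ?thesis unfolding N2[symmetric]
          by (rule insert.IH[OF D sD u]) (use False jk insert.prems(5,6) cX in auto)
      qed
      moreover have "(?N choose l) * ((?N - 2) choose (j - 1)) \<le> ((?N - 2) choose (l - 1)) * (?N choose j)"
        using choose_diagonal_le[of j l ?N] False insert.prems(5) jN by auto
      ultimately have "(card ?D * (?N choose l)) * ((?N - 2) choose (j - 1))
          \<le> (card (avoiders X (l - 1) ?D) * (?N choose j)) * ((?N - 2) choose (j - 1))"
        by (rule mult_chain_le)
      moreover have "(?N - 2) choose (j - 1) > 0" using jN insert.prems(5) False by simp
      ultimately show ?thesis by (meson mult_right_le_imp_le)
    qed
    have "l = 0 \<or> card (avoiders X l ?L) + card (avoiders X (l - 1) ?D) \<le> card (avoiders (insert b X) l H)"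
      using avoiders_insert[OF insert.hyps(1) bX, of "l - 1" H] by (cases l) auto
    then show ?thesis
    proof
      \<comment> \<open>The recursion needs a genuine \<open>l - 1\<close>. Here
        \<open>j = 0\<close> as well, so all unions have at most \<open>k\<close> points and
        \<open>H\<close> has at most one member.\<close>
      assume l0: "l = 0"
      have "avoiders (insert b X) 0 H = {{}}" if ne: "H \<noteq> {}"
      proof -
        have E0: "E = {}" if "E \<subseteq> insert b X" "card E = 0" for E
          using finite_subset[OF that(1) fin] that(2) by simp
        obtain D0 where "D0 \<in> H" using ne by blast
        then have "{} \<in> avoiders (insert b X) 0 H" unfolding avoiders_def by auto
        moreover have "E = {}" if "E \<in> avoiders (insert b X) 0 H" for E
          by (rule E0) (use that in \<open>simp_all add: avoiders_def\<close>)
        ultimately show ?thesis by blast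
      qed
      moreover have "card H \<le> 1"
      proof -
        have "D = D'" if "D \<in> H" "D' \<in> H" for D D'
        proof -
          have "card (D \<union> D') \<le> k" using insert.prems(3)[OF that] insert.prems(5) l0 by simp
          moreover have "card D = k" "card D' = k" using that insert.prems(1) by auto
          ultimately have "D \<union> D' = D" "D \<union> D' = D'"
            using card_seteq[of "D \<union> D'" D] card_seteq[of "D \<union> D'" D'] finD that by auto
          then show ?thesis by blast
        qed
        moreover have "finite H" using HP fin by (rule finite_subset[OF _ finite_Pow_iff[THEN iffD2]])
        ultimately show ?thesis by (simp add: card_le_Suc0_iff_eq)
      qed
      ultimately show ?thesis using l0 insert.prems(5) by (cases "H = {}") auto
    next
      assume le: "card (avoiders X l ?L) + card (avoiders X (l - 1) ?D) \<le> card (avoiders (insert b X) l H)"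
      have "card H * (?N choose l) \<le> (card (avoiders X l ?L) + card (avoiders X (l - 1) ?D)) * (?N choose j)"
        using IHL IHD unfolding cH by (simp add: algebra_simps)
      also have "\<dots> \<le> card (avoiders (insert b X) l H) * (?N choose j)" using le by simp
      finally show ?thesis .
    qed
  qed
qed

text \<open>With \<open>u = 1 - x\<close> and \<open>v = 1 - y\<close>, right side minus left side
  factors as \<open>(v - u) * ((1 - q - p^2) * u + ((1 - p)^2 - q) * v)\<close>. The condition
  \<open>q \<le> (1 - p)^2\<close> is what the extreme case \<open>x = 1\<close>,
  \<open>y = 0\<close> demands.\<close>

lemma density_step:
  fixes p q x y :: real
  assumes "0 \<le> y" "y \<le> x" "x \<le> 1" "0 \<le> p" "p + q \<le> 1" "q \<le> (1 - p)^2" "p \<le> 1" "0 \<le> q"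
  shows "1 - (1 - (p * x + (1 - p) * y))^2
    \<le> (1 - q) * (1 - (1 - x)^2) + q * (1 - (1 - y)^2)"
proof -
  define u where "u = 1 - x"
  define v where "v = 1 - y"
  have uv: "0 \<le> u" "u \<le> v" using assms by (auto simp: u_def v_def)
  have e: "1 - (p * x + (1 - p) * y) = p * u + (1 - p) * v"
    by (simp add: u_def v_def algebra_simps)
  have "p^2 \<le> p" using assms by (simp add: power2_eq_square mult_left_le)
  then have "0 \<le> 1 - q - p^2" using assms by linarith
  then have "0 \<le> (v - u) * ((1 - q - p^2) * u + ((1 - p)^2 - q) * v)"
    using uv assms by (intro mult_nonneg_nonneg add_nonneg_nonneg) auto
  also have "\<dots> = (p * u + (1 - p) * v)^2 - (1 - q) * u^2 - q * v^2"
    by (simp add: power2_eq_square algebra_simps)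
  finally show ?thesis unfolding e u_def[symmetric] v_def[symmetric]
    by (simp add: algebra_simps)
qed

text \<open>Split at the least point \<open>b\<close>: \<open>p = k / M\<close> and
  \<open>q = l / M\<close> are the shares of \<open>k\<close>-sets and \<open>l\<close>-sets
  containing \<open>b\<close>, while \<open>x\<close> and \<open>y\<close> are the densities of link
  and deletion. Shiftedness gives \<open>y \<le> x\<close>, and \<open>density_step\<close> shows
  that the quadratic bound survives the averaging. The condition
  \<open>2 * k + l \<le> card X\<close> passes to both parts and yields
  \<open>q \<le> 1 - 2 * p \<le> (1 - p)^2\<close>.\<close>

lemma avoiders_density:
  fixes X :: "'a::linorder set"
  assumes "finite X" "A \<subseteq> {D. D \<subseteq> X \<and> card D = k}" "left_shifted X A" "2 * k + l \<le> card X"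
  shows "(1 - (1 - real (card A) / real (card X choose k))^2) * real (card X choose l)
    \<le> real (card (avoiders X l A))"
  using assms
proof (induction X arbitrary: A k l rule: finite_linorder_min_induct)
  case empty
  then have kl: "k = 0" "l = 0" and A: "A \<subseteq> {{}}" by auto
  show ?case
  proof (cases "A = {}")
    case False
    then have "A = {{}}" using A by auto
    moreover have "avoiders {} 0 {{}} = {{} :: 'a set}" by (auto simp: avoiders_def)
    ultimately show ?thesis using kl by simp
  qed simp
next
  case (insert b X)
  have bX: "b \<notin> X" using insert.hyps by auto
  define M where "M = card (insert b X)"
  have M: "M = Suc (card X)" using bX insert.hyps by (simp add: M_def)
  have fin: "finite (insert b X)" using insert.hyps by simp
  have AP: "A \<subseteq> Pow (insert b X)" using insert.prems(1) by auto
  show ?case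
  proof (cases "A = {}")
    case True
    then show ?thesis by simp
  next
    case ne: False
    consider "k = 0" | "l = 0" | "k \<ge> 1" "l \<ge> 1" by linarith
    then show ?thesis
    proof cases
      case 1
      have "D = {}" if "D \<in> A" for D
      proof -
        have "D \<subseteq> insert b X" "card D = 0" using that insert.prems(1) 1 by auto
        then show ?thesis using finite_subset[OF _ fin] by simp
      qed
      then have "A = {{}}" using ne by auto
      moreover have "avoiders (insert b X) l {{}} = {E. E \<subseteq> insert b X \<and> card E = l}"
        by (auto simp: avoiders_def)
      ultimately show ?thesis using 1 n_subsets[OF fin, of l] by simp
    next
      case 2
      obtain D where "D \<in> A" using ne by blast
      then have "{} \<in> avoiders (insert b X) 0 A" by (auto simp: avoiders_def)
      then have "card (avoiders (insert b X) 0 A) \<ge> 1"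
        using finite_avoiders[OF fin] by (metis One_nat_def Suc_leI card_gt_0_iff empty_iff)
      then have "1 \<le> real (card (avoiders (insert b X) 0 A))" by simp
      moreover have "1 - (1 - real (card A) / real (card (insert b X) choose k))^2 \<le> 1" by simp
      ultimately have "1 - (1 - real (card A) / real (card (insert b X) choose k))^2
          \<le> real (card (avoiders (insert b X) 0 A))" by (rule order_trans[rotated])
      then show ?thesis unfolding 2 by simp
    next
      case 3
      let ?L = "link X b A" and ?D = "deletion b A"
      define x where "x = real (card ?L) / real (card X choose (k - 1))"
      define y where "y = real (card ?D) / real (card X choose k)"
      define p where "p = real k / real M"
      define q where "q = real l / real M"
      have kM: "2 * k + l \<le> M" using insert.prems(3) by (simp add: M_def)
      have Mpos: "real M > 0" using M by simp
      have L: "?L \<subseteq> {D. D \<subseteq> X \<and> card D = k - 1}"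
      proof
        fix D assume "D \<in> ?L"
        then have D: "D \<subseteq> X" "insert b D \<in> A" by (auto simp: link_def)
        then have "card (insert b D) = k" using insert.prems(1) by auto
        then show "D \<in> {D. D \<subseteq> X \<and> card D = k - 1}"
          using D(1) bX by (metis (mono_tags, lifting) card_insert_disjoint diff_Suc_1 finite_subset insert.hyps(1) mem_Collect_eq subsetD)
      qed
      have D: "?D \<subseteq> {D. D \<subseteq> X \<and> card D = k}"
        using insert.prems(1) by (auto simp: deletion_def)
      have sL: "left_shifted X ?L" and sD: "left_shifted X ?D"
        using left_shifted_link[OF bX] left_shifted_deletion[OF bX] insert.prems(2) by auto
      have IHL: "(1 - (1 - x)^2) * real (card X choose l) \<le> real (card (avoiders X l ?L))"
        unfolding x_def by (rule insert.IH[OF L sL]) (use kM M 3 in linarith)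
      have IHD: "(1 - (1 - y)^2) * real (card X choose (l - 1)) \<le> real (card (avoiders X (l - 1) ?D))"
        unfolding y_def by (rule insert.IH[OF D sD]) (use kM M 3 in linarith)
      have shadow: "card ?D * k \<le> card ?L * (card X - k + 1)"
      proof (rule shadow_LYM[OF insert.hyps(1) D])
        show "?L \<subseteq> Pow X" by (auto simp: link_def)
        show "E - {d} \<in> ?L" if "E \<in> ?D" "d \<in> E" for E d
        proof -
          have E: "E \<in> A" "b \<notin> E" "E \<subseteq> X" using that D by (auto simp: deletion_def)
          moreover have "b < d" using that E insert.hyps by auto
          ultimately have "insert b (E - {d}) \<in> A"
            using left_shiftedD[OF insert.prems(2), of E b d] that by auto
          then show ?thesis using E by (auto simp: link_def)
        qed
        show "card Q = k - 1" if "Q \<in> ?L" for Q using L that by auto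
      qed (use 3 in simp)
      define C where "C = real (M choose k)"
      define B where "B = real (M choose l)"
      have Cpos: "C > 0" using kM by (simp add: C_def)
      have scale: "real ((M - 1) choose (i - 1)) = real i / real M * real (M choose i)"
        "real ((M - 1) choose i) = (1 - real i / real M) * real (M choose i)"
        if "1 \<le> i" "i \<le> M" for i
      proof -
        have "real i * real (M choose i) = real M * real ((M - 1) choose (i - 1))"
          using times_binomial_minus1_eq[of i M] that by (simp flip: of_nat_mult)
        then show "real ((M - 1) choose (i - 1)) = real i / real M * real (M choose i)"
          using Mpos by (simp add: field_simps)
        have "real (M - i) * real (M choose i) = real M * real ((M - 1) choose i)"
          using binomial_absorb_comp[of M i] by (simp flip: of_nat_mult)
        then show "real ((M - 1) choose i) = (1 - real i / real M) * real (M choose i)"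
          using Mpos that by (simp add: field_simps of_nat_diff)
      qed
      have X1: "card X = M - 1" using M by simp
      have Ck: "real (card X choose (k - 1)) = p * C" "real (card X choose k) = (1 - p) * C"
        and Cl: "real (card X choose (l - 1)) = q * B" "real (card X choose l) = (1 - q) * B"
        unfolding p_def q_def C_def B_def X1 using scale[of k] scale[of l] 3 kM by auto
      have p: "0 < p" "p < 1" and q: "0 < q" using 3 kM Mpos by (auto simp: p_def q_def)
      have pq: "p + q \<le> 1" 
      proof -
        have "real (k + l) \<le> real M" using kM by linarith
        then have "real (k + l) / real M \<le> 1" using Mpos by simp
        then show ?thesis by (simp add: p_def q_def add_divide_distrib)
      qed
      have cL: "real (card ?L) = x * (p * C)" using Ck(1) p Cpos by (simp add: x_def)
      have cD: "real (card ?D) = y * ((1 - p) * C)" using Ck(2) p Cpos by (simp add: y_def)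
      have "card ?L \<le> card X choose (k - 1)"
        using card_mono[OF _ L] n_subsets[OF insert.hyps(1), of "k - 1"] insert.hyps(1) by simp
      then have "real (card ?L) \<le> real (card X choose (k - 1))" by (rule of_nat_mono)
      then have "x * (p * C) \<le> 1 * (p * C)" unfolding cL Ck by simp
      then have x1: "x \<le> 1" by (rule mult_right_le_imp_le) (use p Cpos in simp)
      have "real (card ?D * k) \<le> real (card ?L * (card X - k + 1))" using shadow by (rule of_nat_mono)
      moreover have "real (card X - k + 1) = (1 - p) * real M" using kM 3 M Mpos
        by (simp add: p_def field_simps of_nat_diff)
      moreover have "real k = p * real M" using Mpos by (simp add: p_def)
      ultimately have "y * ((1 - p) * C) * (p * real M) \<le> x * (p * C) * ((1 - p) * real M)"
        unfolding of_nat_mult cL cD by (simp only:)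
      then have "y * ((1 - p) * C * p * real M) \<le> x * ((1 - p) * C * p * real M)"
        by (simp only: ac_simps)
      then have yx: "y \<le> x" by (rule mult_right_le_imp_le) (use p Cpos Mpos in simp)
      have "real l * real M \<le> (real M - real k)^2"
      proof -
        have "real l \<le> real M - 2 * real k" using kM by (simp flip: of_nat_mult of_nat_add)
        then have "real l * real M \<le> (real M - 2 * real k) * real M" by (rule mult_right_mono) simp
        also have "\<dots> \<le> (real M - real k)^2" by (simp add: power2_eq_square algebra_simps)
        finally show ?thesis .
      qed
      moreover have "real M - real k = (1 - p) * real M" using Mpos by (simp add: p_def field_simps)
      moreover have "real l = q * real M" using Mpos by (simp add: q_def)
      ultimately have "q * real M ^ 2 \<le> (1 - p)^2 * real M ^ 2"
        by (simp only: power_mult_distrib power2_eq_square ac_simps)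
      then have qp: "q \<le> (1 - p)^2" by (rule mult_right_le_imp_le) (use Mpos in simp)
      have cA: "card A = card ?L + card ?D"
        by (rule card_link_deletion[OF insert.hyps(1) bX AP])
      have al: "real (card A) / C = p * x + (1 - p) * y"
        unfolding cA of_nat_add cL cD using Cpos by (simp add: field_simps)
      have "(1 - (1 - real (card A) / C)^2) * B \<le>
          ((1 - q) * (1 - (1 - x)^2) + q * (1 - (1 - y)^2)) * B"
        unfolding al using density_step[of y x p q] yx x1 p q pq qp
        by (intro mult_right_mono) (auto simp: y_def B_def)
      also have "\<dots> \<le> real (card (avoiders X l ?L)) + real (card (avoiders X (l - 1) ?D))"
        using IHL IHD unfolding Cl by (simp add: algebra_simps)
      also have "\<dots> \<le> real (card (avoiders (insert b X) l A))"
        using avoiders_insert[OF insert.hyps(1) bX, of "l - 1" A] 3 by (simp flip: of_nat_add)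
      finally show ?thesis unfolding B_def C_def M_def .
    qed
  qed
qed

section \<open>Numerical estimates\<close>

lemma choose_step_vertical:
  assumes "2 \<le> N"
  shows "N * (N - 1) * ((N - 2) choose l) = (N - l) * (N - 1 - l) * (N choose l)"
proof -
  have "N * (N - 1) * ((N - 2) choose l) = N * ((N - 1) * ((N - 1 - 1) choose l))"
    by (simp add: numeral_2_eq_2)
  also have "\<dots> = (N - 1 - l) * (N * ((N - 1) choose l))"
    unfolding binomial_absorb_comp[of "N - 1" l, symmetric] by (simp only: ac_simps)
  also have "\<dots> = (N - l) * (N - 1 - l) * (N choose l)"
    unfolding binomial_absorb_comp[of N l, symmetric] by (simp only: ac_simps)
  finally show ?thesis .
qed

text \<open>Dividing the vertical by the diagonal step shows how the ratio of
  \<open>N choose l\<close> to \<open>N choose j\<close> grows when \<open>N\<close> drops by two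
  and \<open>j\<close> by one; iteration gives the geometric factors \<open>3 ^ i\<close> and
  \<open>(5 / 2) ^ (i - 2)\<close>.\<close>

lemma choose_ratio_step:
  fixes c d :: real
  assumes "1 \<le> j" "j < N" "c * real (N choose j) \<le> real (N choose l)" "0 \<le> d"
    and "d * real (j * (N - j)) \<le> real ((N - l) * (N - 1 - l))" "0 \<le> c"
  shows "d * c * real ((N - 2) choose (j - 1)) \<le> real ((N - 2) choose l)"
proof -
  have N: "real (N * (N - 1)) > 0" using assms by auto
  have "real (N * (N - 1)) * (d * c * real ((N - 2) choose (j - 1)))
      = d * c * real (N * (N - 1) * ((N - 2) choose (j - 1)))" by simp
  also have "\<dots> = (d * real (j * (N - j))) * (c * real (N choose j))"
    unfolding choose_step_diagonal[OF assms(1,2)] by simp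
  also have "\<dots> \<le> real ((N - l) * (N - 1 - l)) * real (N choose l)"
    using assms by (intro mult_mono) auto
  also have "\<dots> = real (N * (N - 1)) * real ((N - 2) choose l)"
    using choose_step_vertical[of N l] assms(1,2) by (simp flip: of_nat_mult)
  finally show ?thesis using N by (rule mult_left_le_imp_le)
qed

lemma real_scale_le_3: "3 * real x \<le> real y" if "3 * x \<le> y" for x y :: nat
  using of_nat_mono[OF that, where 'a = real] by simp

lemma real_scale_le_5_2: "5 / 2 * real x \<le> real y" if "5 * x \<le> 2 * y" for x y :: nat
  using of_nat_mono[OF that, where 'a = real] by simp

text \<open>Evaluates Katona's quotient for \<open>fiber {} (k + i)\<close> avoided on level
  \<open>k\<close>, where it competes with \<open>fiber {2,3} k\<close>.\<close>

lemma choose_ratio_3: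
  assumes "4 * k + 2 \<le> m" "i \<le> k"
  shows "3 ^ i * real ((m - 2 * i) choose (k - i)) \<le> real ((m - 2 * i) choose k)"
  using assms(2)
proof (induction i)
  case (Suc i)
  obtain j where "k = Suc i + j" using Suc.prems le_Suc_ex by blast
  then have k: "k = i + Suc j" by simp
  obtain e where m: "m = 4 * k + 2 + e" using assms(1) le_Suc_ex by blast
  have N: "m - 2 * i = 2 * i + 4 * Suc j + 2 + e" unfolding m k by simp
  have "3 * real (Suc j * (m - 2 * i - Suc j)) \<le> real ((m - 2 * i - k) * (m - 2 * i - 1 - k))"
  proof -
    have "3 * (Suc j * (m - 2 * i - Suc j)) \<le> (m - 2 * i - k) * (m - 2 * i - 1 - k)"
      unfolding N unfolding k by (simp add: algebra_simps)
    then show ?thesis by (rule real_scale_le_3)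
  qed
  moreover have "3 ^ i * real ((m - 2 * i) choose Suc j) \<le> real ((m - 2 * i) choose k)"
    using Suc.IH Suc.prems k by simp
  ultimately have "3 * 3 ^ i * real ((m - 2 * i - 2) choose (Suc j - 1)) \<le> real ((m - 2 * i - 2) choose k)"
    by (intro choose_ratio_step) (use N in auto)
  moreover have "m - 2 * Suc i = m - 2 * i - 2" "k - Suc i = Suc j - 1" using k by auto
  ultimately show ?case by simp
qed simp

text \<open>The same quotient one level higher, in competition with \<open>fiber {1} r\<close>. The
  start 20 is attained at \<open>k = 2\<close>, \<open>m = 10\<close>, as \<open>6 choose 3\<close>;
  the step \<open>5 / 2\<close> is a round value below the true growth, which can dip under
  3.\<close>

lemma choose_ratio_20:
  assumes "4 * k + 2 \<le> m" "2 \<le> i" "i \<le> k"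
  shows "20 * (5 / 2) ^ (i - 2) * real ((m - 2 * i) choose (k - i)) \<le> real ((m - 2 * i) choose (k + 1))"
  using assms(2,3)
proof (induction i rule: dec_induct)
  case base
  obtain t where "k = 2 + t" using base le_Suc_ex by blast
  then have t: "k = t + 2" by simp
  obtain e where m: "m = 4 * k + 2 + e" using assms(1) le_Suc_ex by blast
  define N where "N = m - 4"
  have N: "N = 4 * t + 6 + e" using m t by (simp add: N_def)
  have s: "real (a + 1) * real (N choose (a + 1)) = real (N - a) * real (N choose a)" for a
    using binomial_absorb_comp[of N a] binomial_absorption[of a N]
    by (metis Suc_eq_plus1 of_nat_mult)
  have "real (k + 1) * real k * real (k - 1) * real (N choose (k + 1))
      = real k * real (k - 1) * (real (k + 1) * real (N choose (k + 1)))" by (simp only: ac_simps)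
  also have "\<dots> = real (N - k) * real (k - 1) * (real k * real (N choose k))"
    unfolding s[of k] by (simp only: ac_simps)
  also have "real k * real (N choose k) = real (N - (k - 1)) * real (N choose (k - 1))"
    using s[of "k - 1"] t by simp
  also have "real (N - k) * real (k - 1) * (real (N - (k - 1)) * real (N choose (k - 1)))
     = real (N - k) * real (N - (k - 1)) * (real (k - 1) * real (N choose (k - 1)))" by (simp only: ac_simps)
  also have "real (k - 1) * real (N choose (k - 1)) = real (N - (k - 2)) * real (N choose (k - 2))"
    using s[of "k - 2"] t by simp
  finally have e3: "real (k + 1) * real k * real (k - 1) * real (N choose (k + 1))
     = real ((N - k) * (N - (k - 1)) * (N - (k - 2))) * real (N choose (k - 2))" by simp
  have "20 * ((k + 1) * k * (k - 1)) \<le> (N - k) * (N - (k - 1)) * (N - (k - 2))"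
    unfolding N unfolding t by (simp add: algebra_simps)
  then have "real (20 * ((k + 1) * k * (k - 1))) \<le> real ((N - k) * (N - (k - 1)) * (N - (k - 2)))"
    by (simp only: of_nat_le_iff)
  then have "real (20 * ((k + 1) * k * (k - 1))) * real (N choose (k - 2))
      \<le> real (k + 1) * real k * real (k - 1) * real (N choose (k + 1))"
    unfolding e3 by (rule mult_right_mono) simp
  then have "real ((k + 1) * k * (k - 1)) * (20 * real (N choose (k - 2)))
      \<le> real ((k + 1) * k * (k - 1)) * real (N choose (k + 1))"
    by (simp only: of_nat_mult of_nat_numeral ac_simps)
  then have "20 * real (N choose (k - 2)) \<le> real (N choose (k + 1))"
    by (rule mult_left_le_imp_le) (simp only: of_nat_0_less_iff, use t in simp)
  then show ?case by (simp add: N_def)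
next
  case (step i)
  obtain j where "k = Suc i + j" using step.prems le_Suc_ex by blast
  then have k: "k = i + Suc j" by simp
  obtain i' where i: "i = 2 + i'" using step.hyps(1) le_Suc_ex by blast
  obtain e where m: "m = 4 * k + 2 + e" using assms(1) le_Suc_ex by blast
  have N: "m - 2 * i = 2 * i + 4 * Suc j + 2 + e" unfolding m k by simp
  have "5 / 2 * real (Suc j * (m - 2 * i - Suc j)) \<le> real ((m - 2 * i - (k + 1)) * (m - 2 * i - 1 - (k + 1)))"
  proof -
    have "5 * (Suc j * (m - 2 * i - Suc j)) \<le> 2 * ((m - 2 * i - (k + 1)) * (m - 2 * i - 1 - (k + 1)))"
    proof -
      have "m - 2 * i - Suc j = 2 * i' + 3 * j + 9 + e" "m - 2 * i - (k + 1) = i' + 3 * j + 6 + e"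
        "m - 2 * i - 1 - (k + 1) = i' + 3 * j + 5 + e" unfolding m k i by auto
      then show ?thesis by (simp add: algebra_simps)
    qed
    then show ?thesis by (rule real_scale_le_5_2)
  qed
  moreover have "20 * (5/2) ^ (i - 2) * real ((m - 2 * i) choose Suc j) \<le> real ((m - 2 * i) choose (k + 1))"
    using step.IH step.prems k by simp
  ultimately have "5 / 2 * (20 * (5/2) ^ (i - 2)) * real ((m - 2 * i - 2) choose (Suc j - 1)) \<le> real ((m - 2 * i - 2) choose (k + 1))"
    by (intro choose_ratio_step) (use N in auto)
  moreover have "m - 2 * Suc i = m - 2 * i - 2" "k - Suc i = Suc j - 1" "Suc i - 2 = Suc (i - 2)" using k i by auto
  ultimately show ?case by simp
qed

lemma sum_third_powers: "2 \<le> k \<Longrightarrow> (\<Sum>i=3..k. (1/3::real) ^ i) = 1/18 - (1/3) ^ k / 2"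
  by (induction k rule: nat_induct_at_least) (simp_all add: power2_eq_square)

lemma sum_two_fifths_powers: "2 \<le> k \<Longrightarrow> (\<Sum>i=3..k. (2/5::real) ^ (i - 2)) = 2/3 - 2/3 * (2/5) ^ (k - 2)"
proof (induction k rule: nat_induct_at_least)
  case (Suc n)
  then have "Suc n - 2 = Suc (n - 2)" by simp
  then show ?case using Suc by simp
qed simp

text \<open>Below density \<open>3/10\<close> the excess of \<open>M\<close> over \<open>L * a / C\<close> pays for all \<open>h i\<close>;
  above it the \<open>h i\<close> are small because they compete with \<open>a\<close> for room in \<open>C\<close>.\<close>

lemma missing_exceeds_extra:
  fixes a C L M :: real and h :: "nat \<Rightarrow> real"
  assumes k: "1 \<le> k" and a: "0 < a" "a \<le> C"
    and L: "(3 * real k + 2) * C \<le> real (k + 1) * L"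
    and M: "(1 - (1 - a / C)^2) * L \<le> M"
    and h0: "\<And>i. k < i \<Longrightarrow> h i = 0"
    and h3: "\<And>i. 2 \<le> i \<Longrightarrow> i \<le> k \<Longrightarrow> a + 3 ^ i * h i \<le> C"
    and h20: "\<And>i. 2 \<le> i \<Longrightarrow> i \<le> k \<Longrightarrow> 20 * (5 / 2) ^ (i - 2) * h i \<le> M"
  shows "2 * a + 5 * h 2 + 8 * (\<Sum>i=3..k. h i) < M"
proof -
  define t where "t = a / C"
  have C: "C > 0" using a by linarith
  have t: "0 < t" "t \<le> 1" "a = t * C" using a C by (auto simp: t_def)
  have tt: "1 - (1 - t)^2 = t * (2 - t)" by (simp add: power2_eq_square algebra_simps)
  have M': "t * (2 - t) * L \<le> M" using M unfolding t_def[symmetric] tt .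
  show ?thesis
  proof (cases "k = 1")
    case True
    then have "5 * C \<le> 2 * L" using L by simp
    then have "t * (2 - t) * (5/2 * C) \<le> t * (2 - t) * L" using t by (intro mult_left_mono) auto
    then have "t * (2 - t) * (5/2 * C) \<le> M" using M' by linarith
    moreover have "t * 1 \<le> t * (2 - t)" using t by (intro mult_left_mono) auto
    then have "t * 1 * (5/2 * C) \<le> t * (2 - t) * (5/2 * C)" using C by (intro mult_right_mono) auto
    moreover have "2 * a < t * 1 * (5/2 * C)" using t C by simp
    ultimately have "2 * a < M" by linarith
    then show ?thesis using True h0[of 2] by simp
  next
    case False
    then have k2: "2 \<le> k" using k by simp
    \<comment> \<open>The quotient \<open>(3 * k + 2) / (k + 1)\<close> increases with
      \<open>k\<close>: it is \<open>5/2\<close> at \<open>k = 1\<close>, hence the separate case,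
      and \<open>8/3\<close> at \<open>k = 2\<close>.\<close>
    have L83: "8/3 * C \<le> L"
    proof -
      have "8/3 * real (k + 1) \<le> 3 * real k + 2" using k2 by simp
      then have "8/3 * real (k + 1) * C \<le> (3 * real k + 2) * C" using C by (intro mult_right_mono) auto
      then have "real (k + 1) * (8/3 * C) \<le> real (k + 1) * L" using L by (simp add: algebra_simps)
      then show ?thesis by (rule mult_left_le_imp_le) simp
    qed
    have M'': "t * (2 - t) * (8/3 * C) \<le> M"
    proof -
      have "t * (2 - t) * (8/3 * C) \<le> t * (2 - t) * L" using L83 t by (intro mult_left_mono) auto
      then show ?thesis using M' by linarith
    qed
    show ?thesis
    proof (cases "t < 3/10")
      case True
      have "0 < t * (2 - t) * (8/3 * C)" using t C by (intro mult_pos_pos) auto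
      then have Mp: "M > 0" using M'' by linarith
      have "h i \<le> M / 20 * (2/5) ^ (i - 2)" if "2 \<le> i" "i \<le> k" for i
        using h20[OF that] by (simp add: field_simps)
      then have "(\<Sum>i=3..k. h i) \<le> (\<Sum>i=3..k. M / 20 * (2/5) ^ (i - 2))" by (intro sum_mono) auto
      also have "\<dots> = M / 20 * (2/3 - 2/3 * (2/5) ^ (k - 2))"
        unfolding sum_distrib_left[symmetric] sum_two_fifths_powers[OF k2] ..
      also have "\<dots> \<le> M / 20 * (2/3)" using Mp by (intro mult_left_mono) auto
      finally have "8 * (\<Sum>i=3..k. h i) \<le> 4/15 * M" by simp
      moreover have "5 * h 2 \<le> M / 4" using h20[of 2] k2 by simp
      \<comment> \<open>\<open>29/60 = 1 - 1/4 - 4/15\<close> is the share of \<open>M\<close> that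
        the \<open>h i\<close> leave over.\<close>
      moreover have "2 * a < 29/60 * M"
      proof -
        have "t * (17/10) \<le> t * (2 - t)" using t True by (intro mult_left_mono) auto
        then have "t * (17/10) * (8/3 * C) \<le> t * (2 - t) * (8/3 * C)"
          using C by (intro mult_right_mono) auto
        then have "t * (17/10) * (8/3 * C) \<le> M" using M'' by linarith
        then have "68/15 * a \<le> M" using t(3) by (simp add: ac_simps)
        then show ?thesis using a by simp
      qed
      ultimately show ?thesis by simp
    next
      case False
      define d where "d = C - a"
      have "h i \<le> (C - a) * (1/3) ^ i" if "2 \<le> i" "i \<le> k" for i
        using h3[OF that] by (simp add: field_simps)
      note hb = this
      then have "(\<Sum>i=3..k. h i) \<le> (\<Sum>i=3..k. (C - a) * (1/3) ^ i)" by (intro sum_mono) auto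
      also have "\<dots> = (C - a) * (1/18 - (1/3) ^ k / 2)"
        unfolding sum_distrib_left[symmetric] sum_third_powers[OF k2] ..
      also have "\<dots> \<le> (C - a) * (1/18)" using a by (intro mult_left_mono) auto
      finally have "8 * (\<Sum>i=3..k. h i) \<le> 4/9 * d" by (simp add: d_def)
      moreover have "5 * h 2 \<le> 5/9 * d" using hb[of 2] k2 by (simp add: d_def power2_eq_square)
      \<comment> \<open>The \<open>h i\<close> cost \<open>5/9 + 4/9\<close>, exactly one copy of
        \<open>d\<close>. Since \<open>2 * a + d = a + C\<close>, it remains to see
        \<open>1 + t < 8/3 * t * (2 - t)\<close>, which holds for \<open>t\<close> from
        \<open>3/10\<close> to 1.\<close>
      moreover have "2 * a + d < M"
      proof -
        have "0 \<le> (10 * t - 3) * (1 - t)" using False t by (intro mult_nonneg_nonneg) auto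
        moreover have "0 < t * t" using t by simp
        ultimately have "1 + t < t * (2 - t) * (8/3)" by (simp add: algebra_simps)
        then have "(1 + t) * C < t * (2 - t) * (8/3) * C" using C by (rule mult_strict_right_mono)
        then show ?thesis using M'' t by (simp add: d_def algebra_simps)
      qed
      ultimately show ?thesis by linarith
    qed
  qed
qed

section \<open>Shifted down-sets sorted by their trace on the first three points\<close>

lemma sum_Pow_insert:
  assumes "finite A" "x \<notin> A"
  shows "sum f (Pow (insert x A)) = sum f (Pow A) + (\<Sum>T\<in>Pow A. f (insert x T))"
proof -
  have "inj_on (insert x) (Pow A)"
    by (rule inj_on_subset[OF inj_on_insert]) (use assms in auto)
  moreover have "Pow A \<inter> insert x ` Pow A = {}" using assms by auto
  ultimately show ?thesis unfolding Pow_insert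
    using assms by (simp add: sum.union_disjoint sum.reindex)
qed

lemma choose_triple_le:
  assumes "4 * a + 3 \<le> N"
  shows "3 * real (N choose a) \<le> real (N choose (a + 1))"
proof -
  have "real (a + 1) * real (N choose (a + 1)) = real (N - a) * real (N choose a)"
    using binomial_absorb_comp[of N a] binomial_absorption[of a N] by (metis Suc_eq_plus1 of_nat_mult)
  moreover have "3 * (a + 1) \<le> N - a" using assms by simp
  then have "real (3 * (a + 1)) * real (N choose a) \<le> real (N - a) * real (N choose a)"
    by (intro mult_right_mono) (simp_all only: of_nat_le_iff of_nat_0_le_iff)
  ultimately have "real (a + 1) * (3 * real (N choose a)) \<le> real (a + 1) * real (N choose (a + 1))"
    by (simp only: of_nat_mult of_nat_numeral ac_simps)
  then show ?thesis by (rule mult_left_le_imp_le) simp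
qed

lemma scale_le_of_mult_le:
  fixes c :: real and h v x y :: nat
  assumes "h * x \<le> v * y" "c * real y \<le> real x" "0 < y"
  shows "c * real h \<le> real v"
proof -
  have "(c * real h) * real y \<le> real h * real x"
    using mult_left_mono[OF assms(2), of "real h"] by (simp add: ac_simps)
  also have "\<dots> \<le> real v * real y" using of_nat_mono[OF assms(1), where 'a = real] by simp
  finally show ?thesis by (rule mult_right_le_imp_le) (use assms(3) in simp)
qed

locale shifted_family =
  fixes n r :: nat and F :: "nat set set"
  assumes r: "1 \<le> r" and n: "4 * r < n"
    and F_Pow: "F \<subseteq> Pow {1..n}"
    and union: "A \<in> F \<Longrightarrow> B \<in> F \<Longrightarrow> card (A \<union> B) \<le> 2 * r + 1"
    and shifted: "left_shifted {1..n} F"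
    and down: "A \<in> F \<Longrightarrow> B \<subseteq> A \<Longrightarrow> B \<in> F"
begin

abbreviation X :: "nat set" where "X \<equiv> {4..n}"

definition fiber :: "nat set \<Rightarrow> nat \<Rightarrow> nat set set" where
  "fiber T k = {Q. Q \<subseteq> X \<and> card Q = k \<and> T \<union> Q \<in> F}"

lemma shift:
  assumes "S \<in> F" "j \<in> S" "i \<notin> S" "1 \<le> i" "i < j"
  shows "insert i (S - {j}) \<in> F"
proof -
  have "j \<in> {1..n}" using assms(1,2) F_Pow by blast
  then show ?thesis using assms by (intro left_shiftedD[OF shifted]) auto
qed

lemma fiber_subset: "fiber T k \<subseteq> {D. D \<subseteq> X \<and> card D = k}"
  by (auto simp: fiber_def)

lemma finite_fiber: "finite (fiber T k)"
  by (rule finite_subset[OF fiber_subset]) simp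

lemma fiber_antimono: "T' \<subseteq> T \<Longrightarrow> fiber T k \<subseteq> fiber T' k"
  unfolding fiber_def by (auto intro: down[of "T \<union> _" "T' \<union> _"])

lemma fiber_3_2: "fiber {3} k \<subseteq> fiber {2} k"
proof
  fix Q assume "Q \<in> fiber {3} k"
  then have Q: "Q \<subseteq> X" "card Q = k" "{3} \<union> Q \<in> F" by (auto simp: fiber_def)
  have nQ: "2 \<notin> Q" "3 \<notin> Q" using Q(1) by auto
  then have "insert 2 (({3} \<union> Q) - {3}) \<in> F" by (intro shift[OF Q(3)]) auto
  also have "insert 2 (({3} \<union> Q) - {3}) = {2} \<union> Q" using nQ by auto
  finally show "Q \<in> fiber {2} k" using Q by (auto simp: fiber_def)
qed

lemma left_shifted_fiber:
  assumes "T \<subseteq> {1,2,3}"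
  shows "left_shifted X (fiber T k)"
  unfolding left_shifted_def
proof (intro ballI impI)
  fix D i j assume *: "D \<in> fiber T k" "i \<in> X" "j \<in> D" "i < j" "i \<notin> D"
  have D: "D \<subseteq> X" "card D = k" "T \<union> D \<in> F" using *(1) by (auto simp: fiber_def)
  have fD: "finite D" using D(1) finite_subset by blast
  have iT: "i \<notin> T" "j \<notin> T" using assms * D(1) by auto
  have "insert i ((T \<union> D) - {j}) \<in> F" using * iT by (intro shift[OF D(3)]) auto
  also have "insert i ((T \<union> D) - {j}) = T \<union> insert i (D - {j})" using iT by auto
  finally show "insert i (D - {j}) \<in> fiber T k"
    using D * fD card_gt_0_iff[of D] by (auto simp: fiber_def)
qed

lemma fiber_union:
  assumes "T \<subseteq> {1,2,3}" "T' \<subseteq> {1,2,3}" "Q \<subseteq> X" "Q' \<subseteq> X" "T \<union> Q \<in> F" "T' \<union> Q' \<in> F"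
  shows "card (T \<union> T') + card (Q \<union> Q') \<le> 2 * r + 1"
proof -
  have "card ((T \<union> Q) \<union> (T' \<union> Q')) \<le> 2 * r + 1" using union assms by blast
  also have "(T \<union> Q) \<union> (T' \<union> Q') = (T \<union> T') \<union> (Q \<union> Q')" by auto
  also have "card \<dots> = card (T \<union> T') + card (Q \<union> Q')"
  proof (rule card_Un_disjoint)
    show "finite (T \<union> T')" using finite_subset[of _ "{1,2,3::nat}"] assms by blast
    show "finite (Q \<union> Q')" using finite_subset[of _ X] assms by blast
    have "(T \<union> T') \<subseteq> {1,2,3}" "Q \<union> Q' \<subseteq> X" using assms by auto
    moreover have "{1,2,3} \<inter> X = {}" by auto
    ultimately show "(T \<union> T') \<inter> (Q \<union> Q') = {}" by blast
  qed
  finally show ?thesis .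
qed

text \<open>Every loss estimate goes through this. Besides complementary traces it serves the empty
  trace with remainders of size \<open>r - 1 + i\<close>, \<open>2 \<le> i\<close>, which also
  competes with {2,3} and {1}: the forbidden union then has \<open>2 * r + i\<close> points.\<close>

lemma avoiders_fiber_le:
  assumes T: "T \<subseteq> {1,2,3}" "T' \<subseteq> {1,2,3}" and big: "2 * r + 1 < card (T \<union> T') + k + l"
  shows "card (avoiders X l (fiber T k)) + card (fiber T' l) \<le> (n - 3) choose l"
proof -
  have "E \<notin> fiber T' l" if av: "E \<in> avoiders X l (fiber T k)" for E
  proof
    assume E: "E \<in> fiber T' l"
    obtain D where D: "D \<in> fiber T k" "D \<inter> E = {}" using av by (auto simp: avoiders_def)
    have fin: "finite D" "finite E" using D E by (auto simp: fiber_def intro: finite_subset)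
    have "card (T \<union> T') + card (D \<union> E) \<le> 2 * r + 1"
      using D E T by (intro fiber_union) (auto simp: fiber_def)
    moreover have "card (D \<union> E) = k + l" using card_Un_disjoint[OF fin D(2)] D E by (auto simp: fiber_def)
    ultimately show False using big by linarith
  qed
  then have "avoiders X l (fiber T k) \<inter> fiber T' l = {}" by blast
  then have "card (avoiders X l (fiber T k)) + card (fiber T' l) = card (avoiders X l (fiber T k) \<union> fiber T' l)"
    by (intro card_Un_disjoint[symmetric]) (auto intro: finite_avoiders finite_fiber)
  also have "\<dots> \<le> card {E. E \<subseteq> X \<and> card E = l}"
    by (rule card_mono) (auto simp: avoiders_def fiber_def)
  also have "\<dots> = (n - 3) choose l" using n_subsets[of X l] by (simp add: numeral_eq_Suc)
  finally show ?thesis .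
qed

section \<open>Shifting common points onto 1, 2, 3\<close>

lemma shift_many:
  assumes "finite Y" "Y \<subseteq> {1,2,3}" "D \<in> F" "D \<subseteq> X" "Z \<subseteq> D" "card Z = card Y"
  shows "Y \<union> (D - Z) \<in> F"
  using assms
proof (induction Y arbitrary: Z rule: finite_induct)
  case empty
  then have "Z = {}" using finite_subset[of D X] finite_subset[of Z D] by auto
  then show ?case using empty by simp
next
  case (insert y Y)
  have fZ: "finite Z" using insert.prems finite_subset[of D X] finite_subset[of Z D] by auto
  have cZ: "card Z = Suc (card Y)" using insert by simp
  then obtain z where z: "z \<in> Z" by fastforce
  have cZ': "card (Z - {z}) = card Y" using cZ fZ z by simp
  have "Y \<union> (D - (Z - {z})) \<in> F"
    by (rule insert.IH[OF _ insert.prems(2,3) _ cZ']) (use insert.prems(1,4) in auto)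
  moreover have "z \<in> D" "y \<notin> D" "y < z" "1 \<le> y"
  proof -
    show "z \<in> D" using z insert.prems by blast
    then have "4 \<le> z" using insert.prems(3) by auto
    moreover have "1 \<le> y" "y \<le> 3" using insert.prems(1) by auto
    ultimately show "y \<notin> D" "y < z" "1 \<le> y" using insert.prems(3) by auto
  qed
  moreover have "y \<notin> Y" by fact
  ultimately have "insert y ((Y \<union> (D - (Z - {z}))) - {z}) \<in> F"
    by (intro shift) auto
  moreover have "z \<notin> Y"
  proof
    assume "z \<in> Y"
    then have "z \<in> {1,2,3}" "z \<in> X" using z insert.prems by blast+
    then show False by auto
  qed
  then have "insert y ((Y \<union> (D - (Z - {z}))) - {z}) = insert y Y \<union> (D - Z)" using z by auto
  ultimately show ?case by simp
qed

text \<open>Shifting 2 to 1 below \<open>D\<close> shows that \<open>D\<close> and \<open>D'\<close>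
  meet. A common point of \<open>D'\<close> can then be moved to 3 without shrinking
  \<open>D \<union> D'\<close>, so that 1, 2 and 3 all count on top of it.\<close>

lemma fiber_2_union:
  assumes "D \<in> fiber {2} r" "D' \<in> fiber {2} r"
  shows "card (D \<union> D') \<le> 2 * r - 2"
proof -
  have D: "D \<subseteq> X" "card D = r" "{2} \<union> D \<in> F" "D' \<subseteq> X" "card D' = r" "{2} \<union> D' \<in> F"
    using assms by (auto simp: fiber_def)
  have out: "1 \<notin> D" "2 \<notin> D" "3 \<notin> D" "1 \<notin> D'" "2 \<notin> D'" "3 \<notin> D'" using D by auto
  have fin: "finite D" "finite D'" using D finite_subset by blast+
  have "insert 1 (({2} \<union> D) - {2}) \<in> F" using out by (intro shift[OF D(3)]) auto
  moreover have "insert 1 (({2} \<union> D) - {2}) = {1} \<union> D" using out by auto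
  ultimately have D1: "{1} \<union> D \<in> F" by simp
  have "card ({1} \<union> {2::nat}) + card (D \<union> D') \<le> 2 * r + 1"
    by (rule fiber_union) (use D D1 in auto)
  then have "card (D \<union> D') < card D + card D'" using D by simp
  then have "D \<inter> D' \<noteq> {}" using card_Un_disjoint[OF fin] by auto
  then obtain x where x: "x \<in> D" "x \<in> D'" by auto
  have "3 < x" using x D by auto
  then have "insert 3 (({2} \<union> D') - {x}) \<in> F" using x out by (intro shift[OF D(6)]) auto
  moreover have "insert 3 (({2} \<union> D') - {x}) = {2,3} \<union> (D' - {x})" using x out by auto
  ultimately have D2: "{2,3} \<union> (D' - {x}) \<in> F" by simp
  have "card ({1} \<union> {2,3::nat}) + card (D \<union> (D' - {x})) \<le> 2 * r + 1"
    by (rule fiber_union) (use D D1 D2 in auto)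
  moreover have "D \<union> (D' - {x}) = D \<union> D'" using x by auto
  ultimately show ?thesis by simp
qed

text \<open>Up to three common points are moved from \<open>D\<close> to 1, 2, 3 while
  \<open>D'\<close> still covers them. If there were fewer than three, the resulting union would
  have \<open>2 * k\<close> points, too many for \<open>r + 1 \<le> k\<close>.\<close>

lemma fiber_empty_union:
  assumes "D \<in> fiber {} k" "D' \<in> fiber {} k" "r + 1 \<le> k"
  shows "card (D \<union> D') \<le> 2 * r - 2"
proof -
  have D: "D \<subseteq> X" "card D = k" "D \<in> F" "D' \<subseteq> X" "card D' = k" "D' \<in> F"
    using assms by (auto simp: fiber_def)
  have fin: "finite D" "finite D'" using D finite_subset by blast+
  define c where "c = card (D \<inter> D')"
  have cU: "card (D \<union> D') + c = 2 * k" using card_Un_Int[OF fin] D by (simp add: c_def)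
  have "min c 3 \<le> card (D \<inter> D')" by (simp add: c_def)
  then obtain Z where Z: "Z \<subseteq> D \<inter> D'" "card Z = min c 3"
    by (rule obtain_subset_with_card_n)
  have "min c 3 \<le> card {1,2,3::nat}" by simp
  then obtain Y where Y: "Y \<subseteq> {1,2,3::nat}" "card Y = min c 3"
    by (rule obtain_subset_with_card_n)
  have fY: "finite Y" using Y(1) by (rule finite_subset) simp
  have "Y \<union> (D - Z) \<in> F" by (rule shift_many[OF fY Y(1)]) (use D Z Y in auto)
  then have "card (Y \<union> {}) + card ((D - Z) \<union> D') \<le> 2 * r + 1"
    by (intro fiber_union) (use D Y in auto)
  moreover have "(D - Z) \<union> D' = D \<union> D'" using Z by auto
  ultimately have "min c 3 + card (D \<union> D') \<le> 2 * r + 1" using Y by simp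
  then show ?thesis using cU assms(3) by linarith
qed

lemma fiber_empty_high:
  assumes "r + 1 \<le> k" "2 * r - 2 < k"
  shows "fiber {} k = {}"
proof (rule ccontr)
  assume "fiber {} k \<noteq> {}"
  then obtain D where D: "D \<in> fiber {} k" by auto
  then have "card (D \<union> D) \<le> 2 * r - 2" "card D = k"
    by (rule fiber_empty_union[OF _ _ assms(1)], assumption) (use D in \<open>simp add: fiber_def\<close>)
  then show False using assms by simp
qed

text \<open>The union bound \<open>2 * r - 2\<close> is \<open>(r - 1 + i) + (r - 1 - i)\<close>, so
  Katona's theorem applies with \<open>j = r - 1 - i\<close>. This is why levels are indexed by
  their excess \<open>i\<close> over \<open>r - 1\<close>.\<close>

lemma fiber_empty_Katona:
  assumes "2 \<le> i" "i + 1 \<le> r" "r - 1 - i \<le> l" "r - 1 + i + l \<le> n - 3"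
  shows "card (fiber {} (r - 1 + i)) * ((n - 3 - 2 * i) choose l)
    \<le> card (avoiders X l (fiber {} (r - 1 + i))) * ((n - 3 - 2 * i) choose (r - 1 - i))"
proof -
  have cX: "card X = n - 3" by simp
  have e: "card X + (r - 1 - i) - (r - 1 + i) = n - 3 - 2 * i" using cX assms r n by linarith
  have "card (D \<union> D') \<le> (r - 1 + i) + (r - 1 - i)"
    if "D \<in> fiber {} (r - 1 + i)" "D' \<in> fiber {} (r - 1 + i)" for D D'
    using fiber_empty_union[OF that] assms by linarith
  then show ?thesis unfolding e[symmetric]
    by (intro avoiders_Katona[OF _ fiber_subset left_shifted_fiber]) (use assms cX in auto)
qed

text \<open>Katona's theorem with \<open>k = r\<close>, \<open>j = r - 2\<close>,
  \<open>l = r - 1\<close> compares \<open>(n - 5) choose (r - 1)\<close> with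
  \<open>(n - 5) choose (r - 2)\<close>. Trace {3} inherits the union bound from {2} by
  \<open>fiber_3_2\<close>.\<close>

lemma fiber_single_avoiders:
  assumes "2 \<le> r" "T = {2} \<or> T = {3}"
  shows "3 * real (card (fiber T r)) \<le> real (card (avoiders X (r - 1) (fiber T r)))"
proof -
  have cX: "card X = n - 3" by simp
  have sub: "fiber T r \<subseteq> fiber {2} r" using assms fiber_3_2 by auto
  have e: "card X + (r - 2) - r = n - 5" using cX assms n by linarith
  have u: "card (D \<union> D') \<le> r + (r - 2)" if "D \<in> fiber T r" "D' \<in> fiber T r" for D D'
  proof -
    have "card (D \<union> D') \<le> 2 * r - 2" using that sub by (intro fiber_2_union) auto
    then show ?thesis using assms(1) by linarith
  qed
  have le: "card (fiber T r) * ((n - 5) choose (r - 1))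
      \<le> card (avoiders X (r - 1) (fiber T r)) * ((n - 5) choose (r - 2))"
    unfolding e[symmetric]
    by (rule avoiders_Katona[OF _ fiber_subset left_shifted_fiber u]) (use assms cX n in auto)
  have "r - 2 + 1 = r - 1" using assms by simp
  then have "3 * real ((n - 5) choose (r - 2)) \<le> real ((n - 5) choose (r - 1))"
    using choose_triple_le[of "r - 2" "n - 5"] n assms by simp
  with le show ?thesis by (rule scale_le_of_mult_le) (use n in simp)
qed

text \<open>Instance of \<open>missing_exceeds_extra\<close>: \<open>C\<close> and \<open>L\<close>
  are the sizes of the full levels \<open>r - 1\<close> and \<open>r\<close> of \<open>X\<close>,
  \<open>a\<close> is the size of the fiber over {2,3}, \<open>M\<close> counts the
  \<open>r\<close>-sets missing over {1}, and \<open>h i\<close> the members of size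
  \<open>r - 1 + i\<close> over the empty trace. The weight 5 is 8 less the 3 recovered over
  {1,2,3}.\<close>

lemma missing_exceeds_extra_fibers:
  assumes r2: "2 \<le> r" and ne: "fiber {2,3} (r - 1) \<noteq> {}"
  shows "2 * real (card (fiber {2,3} (r - 1))) + 5 * real (card (fiber {} (r + 1)))
      + 8 * (\<Sum>i=3..r - 1. real (card (fiber {} (r - 1 + i))))
    < real ((n - 3) choose r) - real (card (fiber {1} r))"
proof -
  define k where "k = r - 1"
  define m where "m = n - 3"
  define A where "A = fiber {2,3} k"
  define h where "h = (\<lambda>i. real (card (fiber {} (k + i))))"
  have rk: "r = k + 1" and k1: "1 \<le> k" using r2 by (auto simp: k_def)
  have mk: "4 * k + 2 \<le> m" using n rk by (simp add: m_def)
  have cX: "card X = m" by (simp add: m_def)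
  have "2 * real (card A) + 5 * h 2 + 8 * (\<Sum>i=3..k. h i) < real (m choose r) - real (card (fiber {1} r))"
  proof (rule missing_exceeds_extra[where C = "real (m choose k)" and L = "real (m choose r)"])
    show "0 < real (card A)" using ne finite_fiber by (simp add: A_def k_def card_gt_0_iff)
    have "card A \<le> card {D. D \<subseteq> X \<and> card D = k}"
      unfolding A_def by (rule card_mono[OF _ fiber_subset]) simp
    then show "real (card A) \<le> real (m choose k)" using n_subsets[of X k] cX by simp
    have "real (k + 1) * real (m choose r) = real (m - k) * real (m choose k)"
      using binomial_absorb_comp[of m k] binomial_absorption[of k m] by (metis Suc_eq_plus1 of_nat_mult rk)
    moreover have "3 * k + 2 \<le> m - k" using mk by simp
    then have "real (3 * k + 2) * real (m choose k) \<le> real (m - k) * real (m choose k)"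
      by (intro mult_right_mono) (simp_all only: of_nat_le_iff of_nat_0_le_iff)
    ultimately show "(3 * real k + 2) * real (m choose k) \<le> real (k + 1) * real (m choose r)"
      by (simp add: add.commute)
    have "(1 - (1 - real (card A) / real (card X choose k))^2) * real (card X choose r)
        \<le> real (card (avoiders X r A))"
      unfolding A_def by (rule avoiders_density[OF _ fiber_subset left_shifted_fiber]) (use mk rk cX in auto)
    moreover have "card (avoiders X r A) + card (fiber {1} r) \<le> m choose r"
      unfolding A_def m_def by (rule avoiders_fiber_le) (use rk in auto)
    then have "real (card (avoiders X r A)) \<le> real (m choose r) - real (card (fiber {1} r))"
      by (simp flip: of_nat_add)
    ultimately show "(1 - (1 - real (card A) / real (m choose k))^2) * real (m choose r)
        \<le> real (m choose r) - real (card (fiber {1} r))" unfolding cX by linarith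
    show "h i = 0" if "k < i" for i
    proof -
      have "fiber {} (k + i) = {}" using that rk k1 by (intro fiber_empty_high) auto
      then show ?thesis by (simp add: h_def)
    qed
    show "real (card A) + 3 ^ i * h i \<le> real (m choose k)" if i: "2 \<le> i" "i \<le> k" for i
    proof -
      have "card (fiber {} (k + i)) * ((m - 2 * i) choose k)
          \<le> card (avoiders X k (fiber {} (k + i))) * ((m - 2 * i) choose (k - i))"
        by (rule fiber_empty_Katona[of i k, folded k_def m_def]) (use i rk mk in auto)
      then have "3 ^ i * h i \<le> real (card (avoiders X k (fiber {} (k + i))))"
        unfolding h_def by (rule scale_le_of_mult_le[OF _ choose_ratio_3[OF mk i(2)]]) (use i mk in simp)
      moreover have "card (avoiders X k (fiber {} (k + i))) + card A \<le> m choose k"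
        unfolding A_def m_def by (rule avoiders_fiber_le) (use rk i in auto)
      then have "real (card (avoiders X k (fiber {} (k + i)))) + real (card A) \<le> real (m choose k)"
        by (simp flip: of_nat_add)
      ultimately show ?thesis by linarith
    qed
    show "20 * (5 / 2) ^ (i - 2) * h i \<le> real (m choose r) - real (card (fiber {1} r))"
      if i: "2 \<le> i" "i \<le> k" for i
    proof -
      have "card (fiber {} (k + i)) * ((m - 2 * i) choose (k + 1))
          \<le> card (avoiders X (k + 1) (fiber {} (k + i))) * ((m - 2 * i) choose (k - i))"
        by (rule fiber_empty_Katona[of i "k + 1", folded k_def m_def]) (use i rk mk in auto)
      then have "20 * (5 / 2) ^ (i - 2) * h i \<le> real (card (avoiders X (k + 1) (fiber {} (k + i))))"
        unfolding h_def by (rule scale_le_of_mult_le[OF _ choose_ratio_20[OF mk i]]) (use i mk in simp)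
      moreover have "card (avoiders X r (fiber {} (k + i))) + card (fiber {1} r) \<le> m choose r"
        unfolding m_def by (rule avoiders_fiber_le) (use rk i in auto)
      then have "real (card (avoiders X r (fiber {} (k + i)))) + real (card (fiber {1} r)) \<le> real (m choose r)"
        by (simp flip: of_nat_add)
      ultimately show ?thesis unfolding rk by linarith
    qed
  qed (use k1 in auto)
  moreover have "r + 1 = k + 2" using rk by simp
  ultimately show ?thesis unfolding A_def h_def m_def k_def[symmetric] by (simp only:)
qed

lemma fiber_empty_avoiders:
  assumes "2 \<le> r"
  shows "3 * real (card (fiber {} (r + 1))) + real (card (fiber {1,2,3} (r - 2))) \<le> real ((n - 3) choose (r - 2))"
proof (cases "r = 2")
  case True
  \<comment> \<open>For \<open>r = 2\<close> Katona's parameter \<open>r - 3\<close> would truncate,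
    but members inside \<open>X\<close> of size 3 exceed the limit \<open>2 * r - 2\<close>.\<close>
  have "fiber {} (r + 1) = {}" by (rule fiber_empty_high) (use True in auto)
  moreover have "card (fiber {1,2,3} (r - 2)) \<le> card {D. D \<subseteq> X \<and> card D = r - 2}"
    by (rule card_mono[OF _ fiber_subset]) simp
  ultimately show ?thesis using n_subsets[of X "r - 2"] by simp
next
  case False
  then have r3: "3 \<le> r" using assms by simp
  have "r - 1 + 2 = r + 1" "r - 1 - 2 = r - 3" "n - 3 - 2 * 2 = n - 7" using r3 by auto
  then have "card (fiber {} (r + 1)) * ((n - 7) choose (r - 2))
    \<le> card (avoiders X (r - 2) (fiber {} (r + 1))) * ((n - 7) choose (r - 3))"
    using fiber_empty_Katona[of 2 "r - 2"] r3 n by simp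
  moreover have "r - 3 + 1 = r - 2" using r3 by simp
  then have "3 * real ((n - 7) choose (r - 3)) \<le> real ((n - 7) choose (r - 2))"
    using choose_triple_le[of "r - 3" "n - 7"] n r3 by simp
  ultimately have "3 * real (card (fiber {} (r + 1))) \<le> real (card (avoiders X (r - 2) (fiber {} (r + 1))))"
    by (rule scale_le_of_mult_le) (use n in simp)
  moreover have "card (avoiders X (r - 2) (fiber {} (r + 1))) + card (fiber {1,2,3} (r - 2)) \<le> (n - 3) choose (r - 2)"
    by (rule avoiders_fiber_le) (use r3 in auto)
  then have "real (card (avoiders X (r - 2) (fiber {} (r + 1)))) + real (card (fiber {1,2,3} (r - 2))) \<le> real ((n - 3) choose (r - 2))"
    by (simp flip: of_nat_add)
  ultimately show ?thesis by linarith
qed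

section \<open>Counting the upper levels trace by trace\<close>

definition upper :: "nat set \<Rightarrow> nat \<Rightarrow> nat set set" where
  "upper T k = {Q. Q \<subseteq> X \<and> k \<le> card Q \<and> T \<union> Q \<in> F}"

lemma finite_upper: "finite (upper T k)"
  by (rule finite_subset[of _ "Pow X"]) (auto simp: upper_def)

lemma card_level_le:
  "card (level_ge F (r + 1)) \<le> (\<Sum>T\<in>Pow {1,2,3}. card (upper T (r + 1 - card T)))"
proof -
  have "level_ge F (r + 1) \<subseteq> (\<Union>T\<in>Pow {1,2,3}. (\<union>) T ` upper T (r + 1 - card T))"
  proof
    fix S assume "S \<in> level_ge F (r + 1)"
    then have S: "S \<in> F" "r + 1 \<le> card S" by (auto simp: level_ge_def)
    have Sn: "S \<subseteq> {1..n}" using S F_Pow by blast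
    define T where "T = S \<inter> {1,2,3}"
    define Q where "Q = S - {1,2,3}"
    have TQ: "S = T \<union> Q" by (auto simp: T_def Q_def)
    have "finite S" using Sn finite_subset by blast
    then have "card S = card T + card Q" unfolding TQ
      by (intro card_Un_disjoint) (auto simp: T_def Q_def)
    moreover have "Q \<subseteq> X"
    proof
      fix x assume "x \<in> Q"
      then have "x \<in> {1..n}" "x \<noteq> 1" "x \<noteq> 2" "x \<noteq> 3" using Sn by (auto simp: Q_def)
      then show "x \<in> X" by auto
    qed
    ultimately have "Q \<in> upper T (r + 1 - card T)" using S TQ by (auto simp: upper_def)
    moreover have "T \<in> Pow {1,2,3}" by (auto simp: T_def)
    ultimately show "S \<in> (\<Union>T\<in>Pow {1,2,3}. (\<union>) T ` upper T (r + 1 - card T))" using TQ by blast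
  qed
  then have "card (level_ge F (r + 1)) \<le> card (\<Union>T\<in>Pow {1,2,3}. (\<union>) T ` upper T (r + 1 - card T))"
    by (rule card_mono[rotated]) (simp add: finite_upper)
  also have "\<dots> \<le> (\<Sum>T\<in>Pow {1,2,3}. card ((\<union>) T ` upper T (r + 1 - card T)))"
    by (rule card_UN_le) simp
  also have "\<dots> \<le> (\<Sum>T\<in>Pow {1,2,3}. card (upper T (r + 1 - card T)))"
    by (intro sum_mono card_image_le finite_upper)
  finally show ?thesis .
qed

lemma card_upper: "card (upper T k) = card (fiber T k) + card (upper T (k + 1))"
proof -
  have "upper T k = fiber T k \<union> upper T (k + 1)" by (auto simp: upper_def fiber_def)
  moreover have "fiber T k \<inter> upper T (k + 1) = {}" by (auto simp: upper_def fiber_def)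
  ultimately show ?thesis using card_Un_disjoint finite_fiber finite_upper by metis
qed

lemma card_upper_le: "card (upper T k) \<le> card (upper {} k)"
proof (rule card_mono[OF finite_upper], rule subsetI)
  fix Q assume "Q \<in> upper T k"
  then have Q: "Q \<subseteq> X" "k \<le> card Q" "T \<union> Q \<in> F" by (simp_all add: upper_def)
  have "Q \<in> F" by (rule down[OF Q(3)]) blast
  then show "Q \<in> upper {} k" using Q by (simp add: upper_def)
qed

lemma card_upper_empty_le:
  "card (upper {} (r + 1)) \<le> (\<Sum>i=2..r - 1. card (fiber {} (r - 1 + i)))"
proof -
  have "upper {} (r + 1) \<subseteq> (\<Union>i\<in>{2..r - 1}. fiber {} (r - 1 + i))"
  proof
    fix Q assume Q: "Q \<in> upper {} (r + 1)"
    define i where "i = card Q - (r - 1)"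
    have c: "card Q = r - 1 + i" "2 \<le> i" using Q r by (auto simp: upper_def i_def)
    then have Qf: "Q \<in> fiber {} (r - 1 + i)" using Q by (auto simp: upper_def fiber_def)
    have "i \<le> r - 1"
    proof (rule ccontr)
      assume "\<not> i \<le> r - 1"
      then have "fiber {} (r - 1 + i) = {}" using c r by (intro fiber_empty_high) auto
      then show False using Qf by simp
    qed
    then show "Q \<in> (\<Union>i\<in>{2..r - 1}. fiber {} (r - 1 + i))" using Qf c by auto
  qed
  then have "card (upper {} (r + 1)) \<le> card (\<Union>i\<in>{2..r - 1}. fiber {} (r - 1 + i))"
    by (rule card_mono[rotated]) (simp add: finite_fiber)
  also have "\<dots> \<le> (\<Sum>i=2..r - 1. card (fiber {} (r - 1 + i)))" by (rule card_UN_le) simp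
  finally show ?thesis .
qed

text \<open>The traces \<open>{1,3}\<close>, \<open>{1,2}\<close> and \<open>{1,2,3}\<close> lose at least 3 sets for each set in \<open>fiber {2} r\<close>,
  \<open>fiber {3} r\<close> and \<open>fiber {} (r + 1)\<close>. On level \<open>r\<close> this covers the gain, at most
  \<open>2 * card (fiber {2} r) + 4 * card (fiber {3} r)\<close>; trace \<open>{1}\<close> pays for everything else.\<close>

lemma card_level_less:
  assumes r2: "2 \<le> r" and ne: "fiber {2,3} (r - 1) \<noteq> {}"
  shows "card (level_ge F (r + 1)) < (n - 1) choose r"
proof -
  define g where "g = (\<lambda>T k. real (card (fiber T k)))"
  define u where "u = real (card (upper {} (r + 1)))"
  define s where "s = (\<Sum>i=3..r - 1. g {} (r - 1 + i))"
  have mono: "g T k \<le> g T' k" if "T' \<subseteq> T" for T T' k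
    unfolding g_def using card_mono[OF finite_fiber fiber_antimono[OF that]] by simp
  have rr: "r - 2 + 1 = r - 1" "r - 1 + 1 = r" using r2 by auto
  have up1: "real (card (upper T (r + 1))) \<le> u" for T
    unfolding u_def using card_upper_le by simp
  have up0: "real (card (upper T r)) \<le> g T r + u" for T
    using card_upper[of T r] up1[of T] by (simp add: g_def)
  have upm1: "real (card (upper T (r - 1))) \<le> g T (r - 1) + g T r + u" for T
    using card_upper[of T "r - 1"] up0[of T] unfolding rr by (simp add: g_def)
  have upm2: "real (card (upper T (r - 2))) \<le> g T (r - 2) + g T (r - 1) + g T r + u" for T
    using card_upper[of T "r - 2"] upm1[of T] unfolding rr by (simp add: g_def)
  have "u \<le> (\<Sum>i=2..r - 1. g {} (r - 1 + i))"
    unfolding u_def g_def using of_nat_mono[OF card_upper_empty_le, where 'a = real] by simp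
  also have "\<dots> \<le> g {} (r + 1) + s"
  proof (cases "r = 2")
    case False
    then have "(\<Sum>i=2..r - 1. g {} (r - 1 + i)) = g {} (r - 1 + 2) + s"
      unfolding s_def using r2 by (subst sum.atLeast_Suc_atMost) auto
    then show ?thesis using r2 by simp
  qed (simp add: s_def g_def)
  finally have u: "u \<le> g {} (r + 1) + s" .
  have "real (card (level_ge F (r + 1))) \<le> real (\<Sum>T\<in>Pow {1,2,3}. card (upper T (r + 1 - card T)))"
    using card_level_le by (rule of_nat_mono)
  also have "\<dots> = real (card (upper {} (r + 1))) + real (card (upper {1} r)) + real (card (upper {2} r))
      + real (card (upper {3} r)) + real (card (upper {1,2} (r - 1))) + real (card (upper {1,3} (r - 1)))
      + real (card (upper {2,3} (r - 1))) + real (card (upper {1,2,3} (r - 2)))"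
    by (simp add: sum_Pow_insert numeral_3_eq_3[symmetric])
  \<comment> \<open>Each trace is peeled level by level until remainders have at least
    \<open>r + 1\<close> points; these cost at most \<open>u\<close> per trace, hence
    \<open>8 * u\<close>.\<close>
  also have "\<dots> \<le> g {1} r + g {1,2} (r - 1) + g {1,3} (r - 1) + g {1,2,3} (r - 2)
      + g {2,3} (r - 1) + g {1,2,3} (r - 1)
      + g {2} r + g {3} r + g {1,2} r + g {1,3} r + g {2,3} r + g {1,2,3} r + 8 * u"
    using up0[of "{1}"] up0[of "{2}"] up0[of "{3}"] upm1[of "{1,2}"] upm1[of "{1,3}"] upm1[of "{2,3}"]
      upm2[of "{1,2,3}"] unfolding u_def by linarith
  also have "\<dots> \<le> g {1} r + g {1,2} (r - 1) + g {1,3} (r - 1) + g {1,2,3} (r - 2)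
      + 2 * g {2,3} (r - 1) + 2 * g {2} r + 4 * g {3} r + 8 * g {} (r + 1) + 8 * s"
  proof -
    have "g {1,2,3} (r - 1) \<le> g {2,3} (r - 1)" "g {1,2} r \<le> g {2} r" "g {1,3} r \<le> g {3} r"
      "g {2,3} r \<le> g {3} r" "g {1,2,3} r \<le> g {3} r" by (auto intro: mono)
    then show ?thesis using u by linarith
  qed
  finally have total: "real (card (level_ge F (r + 1))) \<le> g {1} r + g {1,2} (r - 1) + g {1,3} (r - 1) + g {1,2,3} (r - 2)
      + 2 * g {2,3} (r - 1) + 2 * g {2} r + 4 * g {3} r + 8 * g {} (r + 1) + 8 * s" .
  have extra: "2 * g {2,3} (r - 1) + 5 * g {} (r + 1) + 8 * s < real ((n - 3) choose r) - g {1} r"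
    using missing_exceeds_extra_fibers[OF r2 ne] unfolding g_def s_def .
  have m13: "3 * g {2} r + g {1,3} (r - 1) \<le> real ((n - 3) choose (r - 1))"
  proof -
    have "card (avoiders X (r - 1) (fiber {2} r)) + card (fiber {1,3} (r - 1)) \<le> (n - 3) choose (r - 1)"
      by (rule avoiders_fiber_le) (use r2 in auto)
    from of_nat_mono[OF this, where 'a = real] show ?thesis
      using fiber_single_avoiders[OF r2, of "{2}"] unfolding g_def by simp
  qed
  have m12: "3 * g {3} r + g {1,2} (r - 1) \<le> real ((n - 3) choose (r - 1))"
  proof -
    have "card (avoiders X (r - 1) (fiber {3} r)) + card (fiber {1,2} (r - 1)) \<le> (n - 3) choose (r - 1)"
      by (rule avoiders_fiber_le) (use r2 in auto)
    from of_nat_mono[OF this, where 'a = real] show ?thesis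
      using fiber_single_avoiders[OF r2, of "{3}"] unfolding g_def by simp
  qed
  have m123: "3 * g {} (r + 1) + g {1,2,3} (r - 2) \<le> real ((n - 3) choose (r - 2))"
    using fiber_empty_avoiders[OF r2] unfolding g_def .
  have g32: "g {3} r \<le> g {2} r" unfolding g_def using card_mono[OF finite_fiber fiber_3_2] by simp
  have "(n - 1) choose r = ((n - 3) choose r) + 2 * ((n - 3) choose (r - 1)) + ((n - 3) choose (r - 2))"
  proof -
    obtain r' where r': "r = Suc (Suc r')" using r2 by (metis One_nat_def Suc_1 Suc_le_D Suc_le_mono)
    obtain m where m: "n = Suc (Suc (Suc m))" using n r2 by (intro that[of "n - 3"]) simp
    show ?thesis unfolding r' m by simp
  qed
  then have "real ((n - 1) choose r)
      = real ((n - 3) choose r) + 2 * real ((n - 3) choose (r - 1)) + real ((n - 3) choose (r - 2))"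
    by simp
  \<comment> \<open>The offer \<open>3 * g {2} r + 3 * g {3} r\<close> of \<open>m13\<close> and
    \<open>m12\<close> covers \<open>2 * g {2} r + 4 * g {3} r\<close> because of
    \<open>g32\<close>; \<open>m123\<close> absorbs 3 of the 8 copies of \<open>g {} (r + 1)\<close>
    and \<open>extra\<close> the other 5.\<close>
  then have "real (card (level_ge F (r + 1))) < real ((n - 1) choose r)"
    using total extra m13 m12 m123 g32 by linarith
  then show ?thesis by simp
qed

text \<open>A violating member misses 1 or has more than \<open>r + 1\<close> points; either way
  \<open>r + 1\<close> points other than 1 remain. Shifting brings in 2 and then 3 while 1 stays
  out, which produces an element of the empty fiber.\<close>

lemma level_subset_full_star:
  assumes "fiber {2,3} (r - 1) = {}"
  shows "level_ge F (r + 1) \<subseteq> full_star n (r + 1)"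
proof
  fix S assume "S \<in> level_ge F (r + 1)"
  then have S: "S \<in> F" "r + 1 \<le> card S" "S \<subseteq> {1..n}" using F_Pow by (auto simp: level_ge_def)
  have fS: "finite S" using S(3) finite_subset by blast
  have "1 \<in> S \<and> card S = r + 1"
  proof (rule ccontr)
    assume neg: "\<not> (1 \<in> S \<and> card S = r + 1)"
    have "r + 1 \<le> card (S - {1})"
      using neg S fS by (cases "1 \<in> S") (auto simp: card_Diff_singleton)
    then obtain D where D: "D \<subseteq> S - {1}" "card D = r + 1" by (rule obtain_subset_with_card_n)
    have fD: "finite D" using D fS finite_subset by blast
    have DF: "D \<in> F" using down S D by blast
    have D2: "2 \<le> x" if "x \<in> D" for x using that D S(3) by force
    obtain E where E: "E \<in> F" "1 \<notin> E" "2 \<in> E" "card E = r + 1" "finite E"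
    proof (cases "2 \<in> D")
      case True
      then show ?thesis using that[of D] DF D fD by auto
    next
      case False
      have "card (D - {3}) > 0" using D fD r by (auto simp: card_Diff_singleton_if)
      then obtain j where j: "j \<in> D" by (auto simp: card_gt_0_iff)
      have "2 < j" using D2[OF j] False j by (metis le_neq_implies_less)
      then have "insert 2 (D - {j}) \<in> F" using j False by (intro shift[OF DF]) auto
      then show ?thesis using that[of "insert 2 (D - {j})"] D fD j False r by auto
    qed
    have E2: "2 \<le> x" if "x \<in> E" for x
    proof -
      have "x \<noteq> 1" using that E(2) by auto
      moreover have "x \<in> {1..n}" using that E(1) F_Pow by blast
      ultimately show ?thesis by auto
    qed
    obtain G where G: "G \<in> F" "1 \<notin> G" "2 \<in> G" "3 \<in> G" "card G = r + 1" "finite G"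
    proof (cases "3 \<in> E")
      case True
      then show ?thesis using that[of E] E by auto
    next
      case False
      have "card (E - {2}) > 0" using E r by simp
      then obtain j where j: "j \<in> E" "j \<noteq> 2" by (auto simp: card_gt_0_iff)
      have "3 < j" using E2[OF j(1)] j False by (cases "j = 3") auto
      then have "insert 3 (E - {j}) \<in> F" using j False by (intro shift[OF E(1)]) auto
      then show ?thesis using that[of "insert 3 (E - {j})"] E j False r by auto
    qed
    have "G \<subseteq> {1..n}" using G F_Pow by auto
    have "G - {2,3} \<subseteq> X"
    proof
      fix x assume x: "x \<in> G - {2,3}"
      then have "x \<in> {1..n}" "x \<noteq> 1" "x \<noteq> 2" "x \<noteq> 3" using \<open>G \<subseteq> {1..n}\<close> G by auto
      then show "x \<in> X" by auto
    qed
    moreover have "card (G - {2,3}) = r - 1" using G by (simp add: card_Diff_subset)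
    moreover have "{2,3} \<union> (G - {2,3}) = G" using G by auto
    ultimately have "G - {2,3} \<in> fiber {2,3} (r - 1)"
      unfolding fiber_def mem_Collect_eq using G(1) by (simp only: simp_thms)
    then show False using assms by simp
  qed
  then show "S \<in> full_star n (r + 1)" using S by (simp add: full_star_def)
qed

text \<open>For \<open>r = 1\<close> the hypothesis puts {2,3} into \<open>F\<close>. A member with
  a point \<open>y \<ge> 4\<close> would lead to \<open>{1, y}\<close>, and
  \<open>{1, 2, 3, y}\<close> is too large a union.\<close>

lemma level_subset_triangle:
  assumes "r = 1" "fiber {2,3} (r - 1) \<noteq> {}"
  shows "level_ge F (r + 1) \<subseteq> {{1,2}, {1,3}, {2,3}, {1,2,3}}"
proof
  fix S assume "S \<in> level_ge F (r + 1)"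
  then have S: "S \<in> F" "2 \<le> card S" "S \<subseteq> {1..n}" using F_Pow assms(1) by (auto simp: level_ge_def)
  obtain Q where "{2,3} \<union> Q \<in> F" using assms(2) by (auto simp: fiber_def)
  then have F23: "{2,3} \<in> F" by (rule down) auto
  have "S \<subseteq> {1,2,3}"
  proof
    fix y assume y: "y \<in> S"
    show "y \<in> {1,2,3}"
    proof (rule ccontr)
      assume y': "y \<notin> {1,2,3}"
      then have y4: "4 \<le> y" using y S(3) by force
      have "card (S - {y}) > 0" using S y by (simp add: card_Diff_singleton)
      then obtain x where x: "x \<in> S" "x \<noteq> y" by (auto simp: card_gt_0_iff)
      have xy: "{x, y} \<in> F" using down[OF S(1)] x y by simp
      have "{1, y} \<in> F"
      proof (cases "x = 1")
        case False
        have "1 < x" using x S(3) False by force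
        then have "insert 1 ({x, y} - {x}) \<in> F" using y4 by (intro shift[OF xy]) auto
        moreover have "insert 1 ({x, y} - {x}) = {1, y}" using x by auto
        ultimately show ?thesis by simp
      qed (use xy in simp)
      then have "card ({1, y} \<union> {2,3}) \<le> 2 * r + 1" using F23 by (rule union)
      moreover have "{1, y} \<union> {2,3} = {1, 2, 3, y}" by auto
      moreover have "card {1, 2, 3, y} = 4" using y4 by simp
      ultimately show False using assms(1) by simp
    qed
  qed
  then have "S \<in> Pow {1,2,3}" by simp
  then show "S \<in> {{1,2}, {1,3}, {2,3}, {1,2,3}}" using S(2) by (auto simp: Pow_insert)
qed

text \<open>When \<open>r = 1\<close> the bound is \<open>n - 1 \<ge> 4\<close>, so the four sets of
  the triangle reach it only for \<open>n = 5\<close>.\<close>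

lemma level_cases:
  "level_ge F (r + 1) \<subseteq> full_star n (r + 1) \<or> card (level_ge F (r + 1)) < (n - 1) choose r
    \<or> (n = 5 \<and> r = 1 \<and> card (level_ge F (r + 1)) \<le> (n - 1) choose r)"
proof (cases "fiber {2,3} (r - 1) = {}")
  case True
  then show ?thesis using level_subset_full_star by blast
next
  case False
  show ?thesis
  proof (cases "r = 1")
    case True
    have "card (level_ge F (r + 1)) \<le> card {{1,2}, {1,3}, {2,3}, {1,2,3::nat}}"
      by (rule card_mono[OF _ level_subset_triangle[OF True False]]) simp
    also have "{{1,2}, {1,3}, {2,3}, {1,2,3::nat}} = set [{1,2}, {1,3}, {2,3}, {1,2,3}]"
      by (simp only: list.set)
    also have "card \<dots> \<le> length [{1,2}, {1,3}, {2,3}, {1,2,3::nat}]" by (rule card_length)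
    finally have le: "card (level_ge F (r + 1)) \<le> 4" by simp
    have c: "(n - 1) choose r = n - 1" using True by simp
    show ?thesis
    proof (cases "n = 5")
      case n5: True
      have "card (level_ge F (r + 1)) \<le> (n - 1) choose r" unfolding c using le n5 by simp
      then show ?thesis using True n5 by blast
    next
      case False
      have "card (level_ge F (r + 1)) < (n - 1) choose r" unfolding c using le n True False by linarith
      then show ?thesis by blast
    qed
  next
    case nr: False
    then have "2 \<le> r" using r by linarith
    then show ?thesis using card_level_less[OF _ False] by blast
  qed
qed

end

section \<open>Stars and shifting\<close>

lemma card_full_star:
  assumes "1 \<le> n"
  shows "card (full_star n (r + 1)) = (n - 1) choose r"
proof -
  have e: "full_star n (r + 1) = insert 1 ` {Q. Q \<subseteq> {2..n} \<and> card Q = r}"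
  proof
    show "full_star n (r + 1) \<subseteq> insert 1 ` {Q. Q \<subseteq> {2..n} \<and> card Q = r}"
    proof
      fix S assume "S \<in> full_star n (r + 1)"
      then have S: "S \<subseteq> {1..n}" "card S = r + 1" "1 \<in> S" by (auto simp: full_star_def)
      have "S - {1} \<subseteq> {2..n}"
      proof
        fix x assume "x \<in> S - {1}"
        then have "x \<in> {1..n}" "x \<noteq> 1" using S(1) by auto
        then show "x \<in> {2..n}" by auto
      qed
      moreover have "card (S - {1}) = r" using S by (simp add: card_Diff_singleton)
      moreover have "S = insert 1 (S - {1})" using S by auto
      ultimately show "S \<in> insert 1 ` {Q. Q \<subseteq> {2..n} \<and> card Q = r}" by blast
    qed
    show "insert 1 ` {Q. Q \<subseteq> {2..n} \<and> card Q = r} \<subseteq> full_star n (r + 1)"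
    proof
      fix S assume "S \<in> insert 1 ` {Q. Q \<subseteq> {2..n} \<and> card Q = r}"
      then obtain Q where Q: "S = insert 1 Q" "Q \<subseteq> {2..n}" "card Q = r" by auto
      have "finite Q" "1 \<notin> Q" using Q(2) finite_subset by auto
      moreover have "Q \<subseteq> {1..n}" using Q(2) by auto
      ultimately show "S \<in> full_star n (r + 1)" using Q assms by (simp add: full_star_def)
    qed
  qed
  have "inj_on (insert 1) {Q. Q \<subseteq> {2..n} \<and> card Q = r}"
    by (rule inj_on_subset[OF inj_on_insert]) auto
  then show ?thesis unfolding e using n_subsets[of "{2..n}" r] by (simp add: card_image)
qed

text \<open>The center is free because undoing a shift can move it; stars become isomorphic copies
  of \<open>full_star\<close> only at the very end.\<close>

definition star :: "nat \<Rightarrow> nat \<Rightarrow> nat \<Rightarrow> nat set set" where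
  "star n k v = {S. S \<subseteq> {1..n} \<and> card S = k \<and> v \<in> S}"

lemma finite_star: "finite (star n k v)"
  by (rule finite_subset[of _ "Pow {1..n}"]) (auto simp: star_def)

lemma star_eq_image:
  assumes "v \<in> {1..n}"
  shows "star n k v = (`) (Transposition.transpose 1 v) ` full_star n k"
proof -
  let ?t = "Transposition.transpose 1 v"
  have perm: "?t permutes {1..n}" using assms by (intro permutes_swap_id) auto
  have inv: "?t ` ?t ` S = S" for S by (simp add: image_image)
  have c: "card (?t ` S) = card S" for S by (intro card_image inj_on_subset[OF permutes_inj[OF perm]]) simp
  have sub: "?t ` S \<subseteq> {1..n}" if "S \<subseteq> {1..n}" for S
    using image_mono[OF that, of ?t] permutes_image[OF perm] by simp
  show ?thesis
  proof
    show "star n k v \<subseteq> (`) ?t ` full_star n k"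
    proof
      fix S assume S: "S \<in> star n k v"
      then have "1 \<in> ?t ` S" by (force simp: star_def)
      then have "?t ` S \<in> full_star n k" using S c sub by (auto simp: star_def full_star_def)
      then show "S \<in> (`) ?t ` full_star n k" using inv[of S] by (metis image_eqI)
    qed
    show "(`) ?t ` full_star n k \<subseteq> star n k v"
    proof
      fix S assume "S \<in> (`) ?t ` full_star n k"
      then obtain R where R: "R \<in> full_star n k" "S = ?t ` R" by auto
      then have "v \<in> S" by (force simp: full_star_def)
      then show "S \<in> star n k v" using R c sub by (auto simp: star_def full_star_def)
    qed
  qed
qed

lemma card_star:
  assumes "v \<in> {1..n}"
  shows "card (star n (r + 1) v) = (n - 1) choose r"
proof -
  have "inj ((`) (Transposition.transpose 1 v))"
    by (rule injI, drule arg_cong[where f = "(`) (Transposition.transpose 1 v)"]) (simp add: image_image)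
  then show ?thesis unfolding star_eq_image[OF assms]
    using card_full_star[of n r] assms by (simp add: card_image inj_on_subset)
qed

section \<open>Compressions and their reversal\<close>

definition shift_set :: "nat set set \<Rightarrow> nat \<Rightarrow> nat \<Rightarrow> nat set \<Rightarrow> nat set" where
  "shift_set L i j S =
    (if j \<in> S \<and> i \<notin> S \<and> insert i (S - {j}) \<notin> L then insert i (S - {j}) else S)"

text \<open>A set that moves leaves \<open>L\<close> and a set that stays is in \<open>L\<close>, so
  only two moved sets could collide, and there the move is reversible.\<close>

lemma shift_set_inj: "i \<noteq> j \<Longrightarrow> inj_on (shift_set L i j) L"
proof (rule inj_onI)
  fix A B assume ij: "i \<noteq> j" and AB: "A \<in> L" "B \<in> L" "shift_set L i j A = shift_set L i j B"
  have "shift_set L i j A = A \<or> shift_set L i j A \<notin> L" by (auto simp: shift_set_def)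
  then consider "shift_set L i j A = A" | "shift_set L i j A \<notin> L" by blast
  then show "A = B"
  proof cases
    case 1
    then have "shift_set L i j B \<in> L" using AB by simp
    then have "shift_set L i j B = B" by (auto simp: shift_set_def split: if_splits)
    then show ?thesis using 1 AB by simp
  next
    case 2
    then have A: "shift_set L i j A = insert i (A - {j})" "j \<in> A" "i \<notin> A"
      using AB by (auto simp: shift_set_def split: if_splits)
    have "shift_set L i j B \<notin> L" using 2 AB by simp
    then have B: "shift_set L i j B = insert i (B - {j})" "j \<in> B" "i \<notin> B"
      using AB by (auto simp: shift_set_def split: if_splits)
    have "insert i (A - {j}) = insert i (B - {j})" using A B AB by simp
    then have "A - {j} = B - {j}" using insert_ident[of i "A - {j}" "B - {j}"] A B by simp
    then show ?thesis using A(2) B(2) by (metis insert_Diff)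
  qed
qed

lemma card_shift_set: "finite S \<Longrightarrow> card (shift_set L i j S) = card S"
  using card_Suc_Diff1[of S j] by (auto simp: shift_set_def card_insert_if)

text \<open>The delicate case is a moved \<open>A\<close> against a fixed \<open>B\<close> with
  \<open>j \<in> B\<close>, \<open>i \<notin> B\<close>. Such a \<open>B\<close> stays only because
  its replacement is already in \<open>L\<close>, and replacing \<open>B\<close> instead of
  \<open>A\<close> gives the same union.\<close>

lemma union_bounded_shift:
  assumes L: "union_bounded u L" and fin: "\<And>S. S \<in> L \<Longrightarrow> finite S" and ij: "i \<noteq> j"
  shows "union_bounded u (shift_set L i j ` L)"
proof -
  have ub: "card (A \<union> B) \<le> u" if "A \<in> L" "B \<in> L" for A B
    using L that by (auto simp: union_bounded_def)
  have mixed: "card (insert i (A - {j}) \<union> B) \<le> u"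
    if A: "A \<in> L" "j \<in> A" "i \<notin> A" and B: "B \<in> L" "shift_set L i j B = B" for A B
  proof -
    consider "i \<in> B" | "i \<notin> B" "j \<notin> B" | "i \<notin> B" "j \<in> B" by blast
    then show ?thesis
    proof cases
      case 1
      have "card (insert i (A - {j}) \<union> B) \<le> card (A \<union> B)"
        by (rule card_mono) (use 1 fin A B in auto)
      then show ?thesis using ub A B by (meson order_trans)
    next
      case 2
      have "insert i (A - {j}) \<union> B = insert i ((A \<union> B) - {j})" using 2 by auto
      moreover have "card (insert i ((A \<union> B) - {j})) = card (A \<union> B)"
      proof -
        have f: "finite (A \<union> B)" "j \<in> A \<union> B" "i \<notin> A \<union> B - {j}" using fin A B 2 by auto
        have "card (insert i ((A \<union> B) - {j})) = Suc (card ((A \<union> B) - {j}))" using f by simp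
        also have "\<dots> = card (A \<union> B)" using f(1,2) by (rule card_Suc_Diff1)
        finally show ?thesis .
      qed
      ultimately show ?thesis using ub A B by metis
    next
      case 3
      then have "insert i (B - {j}) \<in> L" using B by (auto simp: shift_set_def split: if_splits)
      then have "card (A \<union> insert i (B - {j})) \<le> u" using ub A by blast
      moreover have "A \<union> insert i (B - {j}) = insert i (A - {j}) \<union> B" using A 3 by auto
      ultimately show ?thesis by simp
    qed
  qed
  have "card (shift_set L i j A \<union> shift_set L i j B) \<le> u" if AB: "A \<in> L" "B \<in> L" for A B
  proof -
    have dich: "shift_set L i j S = S \<or> (shift_set L i j S = insert i (S - {j}) \<and> j \<in> S \<and> i \<notin> S)" for S
      by (auto simp: shift_set_def)
    consider (1) "shift_set L i j A = A" "shift_set L i j B = B"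
      | (2) "shift_set L i j A \<noteq> A" "shift_set L i j B = B"
      | (3) "shift_set L i j B \<noteq> B" "shift_set L i j A = A"
      | (4) "shift_set L i j A \<noteq> A" "shift_set L i j B \<noteq> B" by blast
    then show ?thesis
    proof cases
      case 1
      then show ?thesis using ub AB by simp
    next
      case 2
      then show ?thesis using mixed[OF AB(1) _ _ AB(2)] dich[of A] by simp
    next
      case 3
      then show ?thesis using mixed[OF AB(2) _ _ AB(1)] dich[of B] by (simp add: Un_commute)
    next
      case 4
      then have AB': "shift_set L i j A = insert i (A - {j})" "j \<in> A" "i \<notin> A"
        "shift_set L i j B = insert i (B - {j})" "i \<notin> B"
        using dich[of A] dich[of B] by simp_all
      have f: "finite (A \<union> B)" "j \<in> A \<union> B" "i \<notin> A \<union> B - {j}" using fin AB AB' by auto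
      have "insert i (A - {j}) \<union> insert i (B - {j}) = insert i ((A \<union> B) - {j})" by auto
      moreover have "card (insert i ((A \<union> B) - {j})) = Suc (card ((A \<union> B) - {j}))" using f by simp
      moreover have "Suc (card ((A \<union> B) - {j})) = card (A \<union> B)" using f(1,2) by (rule card_Suc_Diff1)
      ultimately show ?thesis unfolding AB'(1,4) using ub[OF AB] by simp
    qed
  qed
  then show ?thesis by (auto simp: union_bounded_def)
qed

text \<open>If shifting produced the star at \<open>i\<close>, then every \<open>k - 1\<close> points \<open>Q\<close> off \<open>i, j\<close> are completed
  by exactly one of \<open>i, j\<close> in \<open>L\<close>; disjoint \<open>Q\<close> get the same one, and the Kneser graph is connected.\<close>

lemma unshift_star:
  assumes n: "2 * k + 1 \<le> n" and k: "1 \<le> k" and ij: "i \<in> {1..n}" "j \<in> {1..n}" "i \<noteq> j"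
    and v: "v \<in> {1..n}"
    and L: "L \<subseteq> Pow {1..n}" and ub: "union_bounded (2 * k - 1) L"
    and eq: "shift_set L i j ` L = star n k v"
  shows "\<exists>w\<in>{1..n}. L = star n k w"
proof -
  have fin: "finite S" if "S \<in> L" for S using that L finite_subset by blast
  have card_k: "card S = k" if "S \<in> L" for S
  proof -
    have "shift_set L i j S \<in> star n k v" using that eq by blast
    then show ?thesis using card_shift_set[OF fin[OF that]] by (simp add: star_def)
  qed
  have finL: "finite L" using L finite_subset by blast
  have cL: "card L = card (star n k v)" using card_image[OF shift_set_inj[OF ij(3)], of L] eq by simp
  have cw: "card (star n k w) = card (star n k v)" if "w \<in> {1..n}" for w
    using card_star[OF that, of "k - 1"] card_star[OF v, of "k - 1"] k by simp
  \<comment> \<open>All stars have the size of \<open>L\<close>, so an inclusion is enough.\<close>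
  have fromsub: "\<exists>w\<in>{1..n}. L = star n k w" if w: "w \<in> {1..n}" and sub: "L \<subseteq> star n k w" for w
    using card_subset_eq[OF finite_star sub] cL cw[OF w] w by auto
  have star_of: "w \<in> S \<Longrightarrow> S \<in> L \<Longrightarrow> S \<in> star n k w" for S w
    using L card_k by (auto simp: star_def)
  show ?thesis
  proof (cases "v = i")
    case False
    \<comment> \<open>Shifting introduces no point other than \<open>i\<close>, so \<open>v\<close>
      was present beforehand.\<close>
    have "L \<subseteq> star n k v"
    proof
      fix S assume S: "S \<in> L"
      then have "v \<in> shift_set L i j S" using eq by (auto simp: star_def)
      then have "v \<in> S" using False by (auto simp: shift_set_def split: if_splits)
      then show "S \<in> star n k v" using star_of S by blast
    qed
    then show ?thesis using fromsub v by blast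
  next
    case vi: True
    define Y where "Y = {1..n} - {i, j}"
    have cY: "card Y = n - 2" unfolding Y_def using ij by (simp add: card_Diff_subset)
    have fY: "finite Y" by (simp add: Y_def)
    define Qs where "Qs = {Q. Q \<subseteq> Y \<and> card Q = k - 1}"
    have dis: "insert i Q \<in> L \<or> insert j Q \<in> L" if Q: "Q \<in> Qs" for Q
    proof -
      have Q': "Q \<subseteq> Y" "card Q = k - 1" "finite Q" using Q fY finite_subset by (auto simp: Qs_def)
      have "i \<notin> Q" "j \<notin> Q" using Q' by (auto simp: Y_def)
      then have "insert i Q \<in> star n k v" using Q' k ij vi by (auto simp: star_def Y_def)
      then obtain S where S: "S \<in> L" "shift_set L i j S = insert i Q" using eq by (metis imageE)
      show ?thesis
      proof (cases "shift_set L i j S = S")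
        case True
        then show ?thesis using S by simp
      next
        case False
        then have "shift_set L i j S = insert i (S - {j})" "j \<in> S" "i \<notin> S"
          by (auto simp: shift_set_def split: if_splits)
        then have "insert i Q = insert i (S - {j})" using S by simp
        then have "Q = S - {j}" using insert_ident[of i Q "S - {j}"] \<open>i \<notin> Q\<close> \<open>i \<notin> S\<close> by simp
        then have "insert j Q = S" using \<open>j \<in> S\<close> by auto
        then show ?thesis using S by simp
      qed
    qed
    have excl: "insert i Q \<notin> L" if Q: "Q \<in> Qs" "insert j Q \<in> L" for Q
    proof
      assume iL: "insert i Q \<in> L"
      have nQ: "i \<notin> Q" "j \<notin> Q" using Q by (auto simp: Qs_def Y_def)
      have "insert i (insert j Q - {j}) = insert i Q" using nQ ij by auto
      then have "shift_set L i j (insert j Q) = insert j Q" using iL by (simp add: shift_set_def)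
      then have "insert j Q \<in> star n k v" using Q eq by (metis imageI)
      then show False using vi nQ ij by (auto simp: star_def)
    qed
    have step: "insert j R \<in> L" if Q: "Q \<in> Qs" "insert j Q \<in> L" and R: "R \<in> Qs" "Q \<inter> R = {}" for Q R
    proof (rule ccontr)
      assume "insert j R \<notin> L"
      then have iR: "insert i R \<in> L" using dis[OF R(1)] by simp
      have nQ: "j \<notin> Q" "i \<notin> Q" "i \<notin> R" "j \<notin> R" using Q R by (auto simp: Qs_def Y_def)
      have "insert j Q \<inter> insert i R = {}" using nQ R ij by auto
      then have "card (insert j Q \<union> insert i R) = k + k"
        using card_Un_disjoint[OF fin[OF Q(2)] fin[OF iR]] card_k[OF Q(2)] card_k[OF iR] by simp
      moreover have "card (insert j Q \<union> insert i R) \<le> 2 * k - 1"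
        using ub Q(2) iR unfolding union_bounded_def by blast
      ultimately show False using k by simp
    qed
    have swap: "insert j (insert y (Q - {x})) \<in> L"
      if Q: "Q \<in> Qs" "insert j Q \<in> L" and xy: "x \<in> Q" "y \<in> Y" "y \<notin> Q" for Q x y
    proof -
      have Q': "Q \<subseteq> Y" "card Q = k - 1" "finite Q" using Q fY finite_subset by (auto simp: Qs_def)
      have "card Q > 0" using xy(1) Q'(3) card_gt_0_iff by blast
      then have "card (insert y Q) = k" using Q' xy by simp
      then have "card (Y - insert y Q) = n - 2 - k"
        using Q' xy cY card_Diff_subset[of "insert y Q" Y] by simp
      \<comment> \<open>Room for a common Kneser neighbour \<open>R\<close> of \<open>Q\<close> and
        \<open>insert y (Q - {x})\<close>: \<open>k - 1 \<le> n - 2 - k\<close> is what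
        \<open>2 * k + 1 \<le> n\<close> provides.\<close>
      then have "k - 1 \<le> card (Y - insert y Q)" using n by linarith
      then obtain R where R: "R \<subseteq> Y - insert y Q" "card R = k - 1" by (rule obtain_subset_with_card_n)
      have RQ: "R \<in> Qs" using R by (auto simp: Qs_def)
      have jR: "insert j R \<in> L" by (rule step[OF Q RQ]) (use R in auto)
      have "card (insert y (Q - {x})) = Suc (card (Q - {x}))" using Q'(3) xy by simp
      also have "\<dots> = k - 1" using card_Suc_Diff1[OF Q'(3) xy(1)] Q'(2) by simp
      finally have "card (insert y (Q - {x})) = k - 1" .
      then have "insert y (Q - {x}) \<in> Qs" using Q' xy by (auto simp: Qs_def)
      then show ?thesis by (rule step[OF RQ jR]) (use R in auto)
    qed
    show ?thesis
    proof (cases "\<exists>Q\<in>Qs. insert j Q \<in> L")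
      case True
      then obtain Q0 where Q0: "Q0 \<in> Qs" "insert j Q0 \<in> L" by blast
      \<comment> \<open>Single exchanges, each two steps in the Kneser graph, lead from
        \<open>Q\<close> to any \<open>R\<close> and lower \<open>card (R - Q)\<close> each
        time.\<close>
      have all: "insert j R \<in> L" if R: "R \<in> Qs" and "Q \<in> Qs" "insert j Q \<in> L" for Q R
        using that(2,3)
      proof (induction "card (R - Q)" arbitrary: Q)
        case 0
        have "finite R" "finite Q" using R 0 fY finite_subset by (auto simp: Qs_def)
        then have "R \<subseteq> Q" using 0 by simp
        then have "R = Q" using card_subset_eq[OF \<open>finite Q\<close>] R 0 by (simp add: Qs_def)
        then show ?case using 0 by simp
      next
        case (Suc d)
        have fRQ: "finite R" "finite Q" using R Suc fY finite_subset by (auto simp: Qs_def)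
        have "R - Q \<noteq> {}" using Suc(2) by force
        then obtain y where y: "y \<in> R" "y \<notin> Q" by blast
        have "card (Q - R) = card (R - Q)"
          using card_Diff_subset_Int[of Q R] card_Diff_subset_Int[of R Q] fRQ R Suc.prems
          by (simp add: Qs_def Int_commute)
        then have "Q - R \<noteq> {}" using Suc(2) by force
        then obtain x where x: "x \<in> Q" "x \<notin> R" by blast
        let ?Q = "insert y (Q - {x})"
        have "y \<in> Y" using y R by (auto simp: Qs_def)
        have LQ: "insert j ?Q \<in> L" by (rule swap[OF Suc.prems x(1) \<open>y \<in> Y\<close> y(2)])
        have "card ?Q = card Q" using fRQ x y by (metis Diff_iff card_Suc_Diff1 card_insert_disjoint finite_Diff)
        then have Qs': "?Q \<in> Qs" using Suc.prems \<open>y \<in> Y\<close> by (auto simp: Qs_def)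
        have "R - ?Q = (R - Q) - {y}" using x by auto
        then have "card (R - ?Q) = d" using Suc(2) y fRQ by (simp add: card_Diff_singleton)
        then show ?case using Suc(1)[OF _ Qs' LQ] by simp
      qed
      have "L \<subseteq> star n k j"
      proof
        fix S assume S: "S \<in> L"
        have "j \<in> S"
        proof (rule ccontr)
          assume j: "j \<notin> S"
          then have "shift_set L i j S = S" by (simp add: shift_set_def)
          then have "S \<in> star n k v" using S eq by (metis imageI)
          then have iS: "i \<in> S" using vi by (simp add: star_def)
          have "S - {i} \<in> Qs" using j iS S L card_k[OF S] fin[OF S] by (auto simp: Qs_def Y_def)
          then have "insert j (S - {i}) \<in> L" "insert i (S - {i}) \<notin> L" using all Q0 excl by blast+
          then show False using S iS by (simp add: insert_absorb)
        qed
        then show "S \<in> star n k j" using star_of S by blast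
      qed
      then show ?thesis using fromsub ij by blast
    next
      case False
      have "L \<subseteq> star n k i"
      proof
        fix S assume S: "S \<in> L"
        have "i \<in> S"
        proof (rule ccontr)
          assume i: "i \<notin> S"
          have "shift_set L i j S \<in> star n k v" using S eq by blast
          then have "i \<in> shift_set L i j S" using vi by (simp add: star_def)
          then have j: "j \<in> S" using i by (auto simp: shift_set_def split: if_splits)
          have "S - {j} \<in> Qs" using i j S L card_k[OF S] fin[OF S] by (auto simp: Qs_def Y_def)
          moreover have "insert j (S - {j}) \<in> L" using S j by (simp add: insert_absorb)
          ultimately show False using False by blast
        qed
        then show "S \<in> star n k i" using star_of S by blast
      qed
      then show ?thesis using fromsub ij by blast
    qed
  qed
qed

text \<open>Makes shifting terminate: the moved set \<open>D\<close> loses \<open>j - i\<close> from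
  its element sum and no other sum grows.\<close>

lemma weight_shift_set:
  assumes L: "L \<subseteq> Pow {1..n}" and ij: "i < j"
    and D: "D \<in> L" "j \<in> D" "i \<notin> D" "insert i (D - {j}) \<notin> L"
  shows "(\<Sum>S\<in>shift_set L i j ` L. \<Sum>S) < (\<Sum>S\<in>L. \<Sum>S)"
proof -
  have fin: "finite S" if "S \<in> L" for S using that L finite_subset by blast
  have less: "\<Sum>(insert i (S - {j})) < \<Sum>S" if "S \<in> L" "j \<in> S" "i \<notin> S" for S
  proof -
    have "\<Sum>S = j + \<Sum>(S - {j})" using that fin by (simp add: sum.remove)
    moreover have "\<Sum>(insert i (S - {j})) = i + \<Sum>(S - {j})" using that fin by simp
    ultimately show ?thesis using ij by simp
  qed
  have "(\<Sum>S\<in>shift_set L i j ` L. \<Sum>S) = (\<Sum>S\<in>L. \<Sum>(shift_set L i j S))"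
    using ij by (simp add: sum.reindex[OF shift_set_inj])
  also have "\<dots> < (\<Sum>S\<in>L. \<Sum>S)"
  proof (rule sum_strict_mono_ex1)
    show "finite L" using L finite_subset by blast
    show "\<forall>S\<in>L. \<Sum>(shift_set L i j S) \<le> \<Sum>S"
      using less by (auto simp: shift_set_def intro: less_imp_le)
    have "shift_set L i j D = insert i (D - {j})" using D by (simp add: shift_set_def)
    then show "\<exists>S\<in>L. \<Sum>(shift_set L i j S) < \<Sum>S" using less[OF D(1-3)] D(1) by metis
  qed
  finally show ?thesis .
qed

section \<open>From shifted families to arbitrary ones\<close>

lemma shifted_extremal:
  assumes r: "1 \<le> r" and n: "4 * r < n" and L: "L \<subseteq> Pow {1..n}"
    and big: "\<And>S. S \<in> L \<Longrightarrow> r + 1 \<le> card S" and ub: "union_bounded (2 * r + 1) L"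
    and sh: "left_shifted {1..n} L"
  shows "card L \<le> (n - 1) choose r \<and>
    (card L = (n - 1) choose r \<and> \<not> (n = 5 \<and> r = 1) \<longrightarrow> L = full_star n (r + 1))"
proof -
  \<comment> \<open>The down-closure keeps shiftedness and the union bound, and \<open>L\<close>
    lies in its upper levels, so the bound and the inclusion in the star are inherited by
    \<open>L\<close>.\<close>
  define F where "F = {B. \<exists>S\<in>L. B \<subseteq> S}"
  have finU: "finite (Pow {1..n})" by simp
  interpret shifted_family n r F
  proof
    show "F \<subseteq> Pow {1..n}" using L by (auto simp: F_def)
    show "card (A \<union> B) \<le> 2 * r + 1" if AB: "A \<in> F" "B \<in> F" for A B
    proof -
      obtain S T where ST: "S \<in> L" "T \<in> L" "A \<subseteq> S" "B \<subseteq> T" using AB by (auto simp: F_def)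
      have "finite (S \<union> T)" using ST L finite_subset[of _ "{1..n}"] by auto
      then have "card (A \<union> B) \<le> card (S \<union> T)" by (rule card_mono) (use ST in auto)
      also have "\<dots> \<le> 2 * r + 1" using ub ST(1,2) unfolding union_bounded_def by blast
      finally show ?thesis .
    qed
    show "left_shifted {1..n} F"
      unfolding left_shifted_def
    proof (intro ballI impI)
      fix D i j assume *: "D \<in> F" "i \<in> {1..n}" "j \<in> D" "i < j" "i \<notin> D"
      obtain S where S: "S \<in> L" "D \<subseteq> S" using *(1) by (auto simp: F_def)
      show "insert i (D - {j}) \<in> F"
      proof (cases "i \<in> S")
        case True
        then have "insert i (D - {j}) \<subseteq> S" using S by auto
        then show ?thesis using S by (auto simp: F_def)
      next
        case False
        then have "insert i (S - {j}) \<in> L" using left_shiftedD[OF sh S(1) *(2)] * S by auto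
        moreover have "insert i (D - {j}) \<subseteq> insert i (S - {j})" using S by auto
        ultimately show ?thesis unfolding F_def by blast
      qed
    qed
    show "B \<in> F" if "A \<in> F" "B \<subseteq> A" for A B using that by (auto simp: F_def)
  qed (use r n in auto)
  have sub: "L \<subseteq> level_ge F (r + 1)" using big by (auto simp: F_def level_ge_def)
  have "finite (level_ge F (r + 1))"
    by (rule finite_subset[OF _ finU]) (use F_Pow in \<open>auto simp: level_ge_def\<close>)
  then have le: "card L \<le> card (level_ge F (r + 1))" using sub by (rule card_mono)
  have cf: "card (full_star n (r + 1)) = (n - 1) choose r" using n by (intro card_full_star) simp
  have ff: "finite (full_star n (r + 1))"
    by (rule finite_subset[OF _ finU]) (auto simp: full_star_def)
  consider "level_ge F (r + 1) \<subseteq> full_star n (r + 1)" | "card (level_ge F (r + 1)) < (n - 1) choose r"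
    | "n = 5 \<and> r = 1" "card (level_ge F (r + 1)) \<le> (n - 1) choose r"
    using level_cases by blast
  then show ?thesis
  proof cases
    case 1
    then have s: "L \<subseteq> full_star n (r + 1)" using sub by blast
    then show ?thesis using card_mono[OF ff s] card_subset_eq[OF ff s] cf by simp
  next
    case 2
    then show ?thesis using le by linarith
  next
    case 3
    then show ?thesis using le by linarith
  qed
qed

lemma level_extremal:
  assumes r: "1 \<le> r" and n: "4 * r < n"
    and "L \<subseteq> Pow {1..n}" "\<And>S. S \<in> L \<Longrightarrow> r + 1 \<le> card S" "union_bounded (2 * r + 1) L"
  shows "card L \<le> (n - 1) choose r \<and>
    (card L = (n - 1) choose r \<and> \<not> (n = 5 \<and> r = 1) \<longrightarrow> (\<exists>v\<in>{1..n}. L = star n (r + 1) v))"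
  using assms(3-5)
proof (induction "\<Sum>S\<in>L. \<Sum>S" arbitrary: L rule: less_induct)
  case less
  show ?case
  proof (cases "left_shifted {1..n} L")
    case True
    have "full_star n (r + 1) = star n (r + 1) 1" by (auto simp: full_star_def star_def)
    moreover have "1 \<in> {1..n}" using n by simp
    ultimately show ?thesis using shifted_extremal[OF r n less.prems True] by metis
  next
    case False
    then obtain D i j where D: "D \<in> L" "i \<in> {1..n}" "j \<in> D" "i < j" "i \<notin> D" "insert i (D - {j}) \<notin> L"
      unfolding left_shifted_def by blast
    have ij: "i \<noteq> j" "j \<in> {1..n}" using D(1,3,4) less.prems(1) by blast+
    have fin: "finite S" if "S \<in> L" for S using that less.prems(1) finite_subset by blast
    let ?L = "shift_set L i j ` L"
    have w: "(\<Sum>S\<in>?L. \<Sum>S) < (\<Sum>S\<in>L. \<Sum>S)"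
      by (rule weight_shift_set[OF less.prems(1) D(4,1,3,5,6)])
    have sub: "?L \<subseteq> Pow {1..n}" using less.prems(1) D(2) by (auto simp: shift_set_def)
    have big: "r + 1 \<le> card S" if "S \<in> ?L" for S
      using that less.prems(2) card_shift_set[OF fin] by auto
    have ub: "union_bounded (2 * r + 1) ?L"
      by (rule union_bounded_shift[OF less.prems(3) fin ij(1)])
    have card: "card ?L = card L" by (rule card_image[OF shift_set_inj[OF ij(1)]])
    have IH: "card ?L \<le> (n - 1) choose r \<and>
      (card ?L = (n - 1) choose r \<and> \<not> (n = 5 \<and> r = 1) \<longrightarrow> (\<exists>v\<in>{1..n}. ?L = star n (r + 1) v))"
      by (rule less.hyps[OF w sub big ub])
    have "\<exists>w\<in>{1..n}. L = star n (r + 1) w" if v: "v \<in> {1..n}" "?L = star n (r + 1) v" for v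
    proof (rule unshift_star[OF _ _ D(2) ij(2,1) v(1) less.prems(1) _ v(2)])
      \<comment> \<open>The Kneser argument for \<open>(r + 1)\<close>-sets needs
        \<open>2 * r + 3\<close> points, and \<open>4 * r + 1\<close> suffice because
        \<open>1 \<le> r\<close>.\<close>
      show "2 * (r + 1) + 1 \<le> n" using r n by simp
      show "union_bounded (2 * (r + 1) - 1) L" using less.prems(3) by simp
    qed simp
    then show ?thesis using IH unfolding card by blast
  qed
qed

theorem theorem1p10:
  fixes n r :: nat and \<F> :: "nat set set"
  assumes "n > 0" and "r > 0" and "n > 4 * r"
    and "\<F> \<subseteq> Pow {1..n}"
    and "union_bounded (2 * r + 1) \<F>"
  shows "card (level_ge \<F> (r + 1)) \<le> (n - 1) choose r
    \<and> (isomorphic_families n (level_ge \<F> (r + 1)) (full_star n (r + 1))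
         \<longrightarrow> card (level_ge \<F> (r + 1)) = (n - 1) choose r)
    \<and> (card (level_ge \<F> (r + 1)) = (n - 1) choose r \<and> \<not> (n = 5 \<and> r = 1)
         \<longrightarrow> isomorphic_families n (level_ge \<F> (r + 1)) (full_star n (r + 1)))"
proof -
  let ?L = "level_ge \<F> (r + 1)"
  have ext: "card ?L \<le> (n - 1) choose r \<and>
    (card ?L = (n - 1) choose r \<and> \<not> (n = 5 \<and> r = 1) \<longrightarrow> (\<exists>v\<in>{1..n}. ?L = star n (r + 1) v))"
  proof (rule level_extremal)
    show "?L \<subseteq> Pow {1..n}" using assms(4) by (auto simp: level_ge_def)
    show "r + 1 \<le> card S" if "S \<in> ?L" for S using that by (simp add: level_ge_def)
    show "union_bounded (2 * r + 1) ?L" using assms(5) by (simp add: union_bounded_def level_ge_def)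
  qed (use assms in auto)
  have iso: "isomorphic_families n ?L (full_star n (r + 1))"
    if v: "v \<in> {1..n}" "?L = star n (r + 1) v" for v
  proof -
    have "Transposition.transpose 1 v permutes {1..n}"
      using assms(1) v(1) by (intro permutes_swap_id) auto
    then show ?thesis unfolding isomorphic_families_def v(2) using star_eq_image[OF v(1)] by blast
  qed
  have "card ?L = (n - 1) choose r" if "isomorphic_families n ?L (full_star n (r + 1))"
  proof -
    obtain \<pi> where \<pi>: "\<pi> permutes {1..n}" "?L = (`) \<pi> ` full_star n (r + 1)"
      using \<open>isomorphic_families _ _ _\<close> unfolding isomorphic_families_def by blast
    have "inj ((`) \<pi>)" using permutes_inj[OF \<pi>(1)] by (simp add: inj_def inj_image_eq_iff)
    then have "card ?L = card (full_star n (r + 1))"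
      unfolding \<pi>(2) by (intro card_image) (rule inj_on_subset, auto)
    then show ?thesis using card_full_star[of n r] assms(1) by simp
  qed
  then show ?thesis using ext iso by blast
qed

end
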